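(* Let $k\in\{1,2,3,\ldots\}$ and let $\varphi_k:\mathbb{T}^2\to\mathbb{S}^2\subset\mathbb{R}^3$ be the proper biharmonic map $$\varphi_k(\gamma,\vartheta)=\left(\sin(\alpha^* )\cos(k\gamma),\ \sin(\alpha^* )\sin(k\gamma),\ \cos(\alpha^* )\right),\qquad \alpha^*=\frac{\pi}{4}.$$ For integers $m,n\ge1$ set $$\lambda_{m,n}^{-}=\tfrac12\Big(-k^4+k^2(5m^2+n^2)+2(m^2+n^2)^2-\sqrt{k^8+2k^6(m^2+n^2)+k^4(m^2+n^2)^2+32k^2m^2(m^2+n^2)^2}\Big),$$ and let $f(k)$ (respectively $g(k)$) be the number of pairs $(m,n)$ of positive integers such that $\lambda_{m,n}^-<0$ (respectively $\lambda_{m,n}^-=0$). Then $$\mathrm{Nullity}(\varphi_k)=5+4\,g(k),\qquad \mathrm{Index}(\varphi_k)=1+4(k-1)+4\,f(k).$$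
   Context: $\mathbb{T}^2=(\mathbb{S}^1\times\mathbb{S}^1,\ d\gamma^2+d\vartheta^2)$, $0\le\gamma,\vartheta\le 2\pi$, is the flat torus (both circles of length $2\pi$), and $\mathbb{S}^2$ is the unit sphere. For a smooth map $\varphi:M\to N$ of Riemannian manifolds, $M$ compact, the tension field is $\tau(\varphi)=\mathrm{trace}\,\nabla d\varphi$, and the bienergy is $E_2(\varphi)=\frac12\int_M|\tau(\varphi)|^2\,dv_M$. Biharmonic maps are the critical points of $E_2$; a biharmonic map is proper if it is not harmonic, i.e. $\tau(\varphi)\not\equiv0$. For a biharmonic map $\varphi$ and a two-parameter smooth variation $\varphi_{t,s}$ with $\varphi_{0,0}=\varphi$, $V=\frac{d}{dt}|_{t=0}\varphi_{t,0}$, $W=\frac{d}{ds}|_{s=0}\varphi_{0,s}$, the Hessian is $H(E_2)_\varphi(V,W)=\frac{\partial^2}{\partial t\partial s}|_{(0,0)}E_2(\varphi_{t,s})=\int_M\langle I_2(V),W\rangle\,dv_M$, where the second variation operator $I_2$ acts on the space $\mathcal{C}(\varphi^{-1}TN)$ of smooth sections of the pull-back bundle $\varphi^{-1}TN$. When $N=\mathbb{S}^n$ is the unit sphere, with $\{e_i\}$ a local orthonormal frame of $M$, $\nabla^\varphi$ the induced connection on $\varphi^{-1}TN$ and $\overline{\Delta}=-\sum_i(\nabla^\varphi_{e_i}\nabla^\varphi_{e_i}-\nabla^\varphi_{\nabla^M_{e_i}e_i})$, it is $$\begin{aligned}I_2(V)=\ &\overline{\Delta}^2V+\overline{\Delta}\big(T(V)-|d\varphi|^2V\big)+2\langle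 d\tau(\varphi),d\varphi\rangle V+|\tau(\varphi)|^2V-2\sum_i\langle V,\nabla^\varphi_{e_i}\tau(\varphi)\rangle d\varphi(e_i)\\&-2\sum_i\langle\tau(\varphi),\nabla^\varphi_{e_i}V\rangle d\varphi(e_i)-\langle\tau(\varphi),V\rangle\tau(\varphi)+T(\overline{\Delta}V)+T(T(V))-2|d\varphi|^2T(V)\\&+2\langle dV,d\varphi\rangle\tau(\varphi)-|d\varphi|^2\overline{\Delta}V+|d\varphi|^4V,\end{aligned}$$ where $T(V)=\sum_i\langle V,d\varphi(e_i)\rangle d\varphi(e_i)$, $\langle d\tau(\varphi),d\varphi\rangle=\sum_i\langle\nabla^\varphi_{e_i}\tau(\varphi),d\varphi(e_i)\rangle$ and $\langle dV,d\varphi\rangle=\sum_i\langle\nabla^\varphi_{e_i}V,d\varphi(e_i)\rangle$. Since $M$ is compact, $I_2$ has discrete spectrum $\lambda_1<\lambda_2<\cdots\to+\infty$ with finite-dimensional eigenspaces $\mathcal{V}_i$. Then $\mathrm{Index}(\varphi)=\sum_{\lambda_i<0}\dim\mathcal{V}_i$ and $\mathrm{Nullity}(\varphi)=\dim\{V\in\mathcal{C}(\varphi^{-1}TN): I_2(V)=0\}$. *)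

theory Defs
  imports "HOL-Analysis.Analysis" "HOL-Library.Function_Algebras" "HOL-Library.Extended_Nat"
begin

section \<open>Functions as a real vector space\<close>

instantiation "fun" :: (type, real_vector) real_vector
begin

definition "c *\<^sub>R f = (\<lambda>x. c *\<^sub>R f x)"

instance
  by standard (auto simp: scaleR_fun_def scaleR_add_right scaleR_add_left)

end

text \<open>The library's \<^const>\<open>dim\<close> is \<open>0\<close> on infinite-dimensional spaces; here such spaces get
  dimension \<open>\<infinity>\<close>, so that a finite value really asserts finite-dimensionality.\<close>

definition edim :: "'a::real_vector set \<Rightarrow> enat" where
  "edim S = (if \<exists>B. finite B \<and> S \<subseteq> span B then enat (dim S) else \<infinity>)"


section \<open>Smooth functions\<close>

primrec C_k :: "nat \<Rightarrow> ('a::euclidean_space \<Rightarrow> 'b::real_normed_vector) \<Rightarrow> bool" where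
  "C_k 0 f \<longleftrightarrow> continuous_on UNIV f"
| "C_k (Suc n) f \<longleftrightarrow> f differentiable_on UNIV \<and> (\<forall>v. C_k n (\<lambda>x. frechet_derivative f (at x) v))"

definition smooth :: "('a::euclidean_space \<Rightarrow> 'b::real_normed_vector) \<Rightarrow> bool" where
  "smooth f \<longleftrightarrow> (\<forall>n. C_k n f)"


section \<open>Maps from the flat torus to the unit sphere\<close>

text \<open>The flat torus is \<open>\<real>\<^sup>2\<close> modulo \<open>2\<pi>\<int>\<^sup>2\<close>, so functions on it are the doubly \<open>2\<pi>\<close>-periodic
  functions of \<open>(\<gamma>, \<theta>)\<close>. The two elements \<open>(1, 0)\<close> and \<open>(0, 1)\<close> of \<^const>\<open>Basis\<close> form a global
  orthonormal frame which is parallel, so the terms \<open>\<nabla>\<^sup>M\<^bsub>e\<^esub> e\<close> vanish. The target is the unit sphere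
  \<open>sphere 0 1\<close> of a Euclidean space, and vectors tangent to it are regarded as vectors of that
  space.\<close>

definition torus_periodic :: "(real \<times> real \<Rightarrow> 'b) \<Rightarrow> bool" where
  "torus_periodic f \<longleftrightarrow> (\<forall>x y. f (x + 2 * pi, y) = f (x, y) \<and> f (x, y + 2 * pi) = f (x, y))"

definition torus_sphere_map :: "(real \<times> real \<Rightarrow> 'b::euclidean_space) \<Rightarrow> bool" where
  "torus_sphere_map \<phi> \<longleftrightarrow> smooth \<phi> \<and> torus_periodic \<phi> \<and> (\<forall>p. \<phi> p \<in> sphere 0 1)"

definition pderiv_dir ::
    "real \<times> real \<Rightarrow> (real \<times> real \<Rightarrow> 'b::euclidean_space) \<Rightarrow> real \<times> real \<Rightarrow> 'b" where
  "pderiv_dir e f p = frechet_derivative f (at p) e"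

text \<open>The connection \<open>\<nabla>\<^sup>\<phi>\<close> induced by the Levi-Civita connection of the sphere, i.e. the derivative in
  the ambient space followed by the orthogonal projection onto the tangent space at \<open>\<phi> p\<close>.\<close>

definition cov_deriv ::
    "(real \<times> real \<Rightarrow> 'b::euclidean_space) \<Rightarrow> real \<times> real \<Rightarrow> (real \<times> real \<Rightarrow> 'b) \<Rightarrow> real \<times> real \<Rightarrow> 'b" where
  "cov_deriv \<phi> e V p = pderiv_dir e V p - (pderiv_dir e V p \<bullet> \<phi> p) *\<^sub>R \<phi> p"

definition tension :: "(real \<times> real \<Rightarrow> 'b::euclidean_space) \<Rightarrow> real \<times> real \<Rightarrow> 'b" where
  "tension \<phi> p = (\<Sum>e\<in>Basis. cov_deriv \<phi> e (pderiv_dir e \<phi>) p)"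

definition bienergy :: "(real \<times> real \<Rightarrow> 'b::euclidean_space) \<Rightarrow> real" where
  "bienergy \<phi> = 1 / 2 * integral (cbox (0, 0) (2 * pi, 2 * pi)) (\<lambda>p. (norm (tension \<phi> p))\<^sup>2)"

text \<open>The variation parameter runs over all of \<open>\<real>\<close>; a variation over \<open>]-\<epsilon>, \<epsilon>[\<close> becomes one of this
  kind by reparametrisation, which rescales the derivative at \<open>0\<close> by a nonzero factor.\<close>

definition smooth_variation ::
    "(real \<times> real \<Rightarrow> 'b::euclidean_space) \<Rightarrow> (real \<Rightarrow> real \<times> real \<Rightarrow> 'b) \<Rightarrow> bool" where
  "smooth_variation \<phi> \<Phi> \<longleftrightarrow>
     smooth (\<lambda>(t, p). \<Phi> t p) \<and> (\<forall>t. torus_sphere_map (\<Phi> t)) \<and> \<Phi> 0 = \<phi>"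

definition biharmonic :: "(real \<times> real \<Rightarrow> 'b::euclidean_space) \<Rightarrow> bool" where
  "biharmonic \<phi> \<longleftrightarrow> torus_sphere_map \<phi> \<and>
     (\<forall>\<Phi>. smooth_variation \<phi> \<Phi> \<longrightarrow> ((\<lambda>t. bienergy (\<Phi> t)) has_real_derivative 0) (at 0))"

definition proper_biharmonic :: "(real \<times> real \<Rightarrow> 'b::euclidean_space) \<Rightarrow> bool" where
  "proper_biharmonic \<phi> \<longleftrightarrow> biharmonic \<phi> \<and> (\<exists>p. tension \<phi> p \<noteq> 0)"


section \<open>The second variation operator\<close>

definition sections :: "(real \<times> real \<Rightarrow> 'b::euclidean_space) \<Rightarrow> (real \<times> real \<Rightarrow> 'b) set" where
  "sections \<phi> = {V. smooth V \<and> torus_periodic V \<and> (\<forall>p. V p \<bullet> \<phi> p = 0)}"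

definition rough_laplacian ::
    "(real \<times> real \<Rightarrow> 'b::euclidean_space) \<Rightarrow> (real \<times> real \<Rightarrow> 'b) \<Rightarrow> real \<times> real \<Rightarrow> 'b" where
  "rough_laplacian \<phi> V p = - (\<Sum>e\<in>Basis. cov_deriv \<phi> e (cov_deriv \<phi> e V) p)"

definition normsq_d :: "(real \<times> real \<Rightarrow> 'b::euclidean_space) \<Rightarrow> real \<times> real \<Rightarrow> real" where
  "normsq_d \<phi> p = (\<Sum>e\<in>Basis. (norm (pderiv_dir e \<phi> p))\<^sup>2)"

definition trace_op ::
    "(real \<times> real \<Rightarrow> 'b::euclidean_space) \<Rightarrow> (real \<times> real \<Rightarrow> 'b) \<Rightarrow> real \<times> real \<Rightarrow> 'b" where
  "trace_op \<phi> V p = (\<Sum>e\<in>Basis. (V p \<bullet> pderiv_dir e \<phi> p) *\<^sub>R pderiv_dir e \<phi> p)"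

text \<open>\<open>inner_d \<phi> V\<close> is \<open>\<langle>dV, d\<phi>\<rangle>\<close>.\<close>

definition inner_d ::
    "(real \<times> real \<Rightarrow> 'b::euclidean_space) \<Rightarrow> (real \<times> real \<Rightarrow> 'b) \<Rightarrow> real \<times> real \<Rightarrow> real" where
  "inner_d \<phi> V p = (\<Sum>e\<in>Basis. cov_deriv \<phi> e V p \<bullet> pderiv_dir e \<phi> p)"

text \<open>The operator \<open>I\<^sub>2\<close> with \<open>H(E\<^sub>2)\<^sub>\<phi>(V, W) = \<integral>\<langle>I\<^sub>2 V, W\<rangle>\<close>, in its explicit form for maps into a unit
  sphere; the summands are in the usual order.\<close>

definition second_variation ::
    "(real \<times> real \<Rightarrow> 'b::euclidean_space) \<Rightarrow> (real \<times> real \<Rightarrow> 'b) \<Rightarrow> real \<times> real \<Rightarrow> 'b" where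
  "second_variation \<phi> V p =
       rough_laplacian \<phi> (rough_laplacian \<phi> V) p
     + rough_laplacian \<phi> (\<lambda>q. trace_op \<phi> V q - normsq_d \<phi> q *\<^sub>R V q) p
     + (2 * inner_d \<phi> (tension \<phi>) p) *\<^sub>R V p
     + (norm (tension \<phi> p))\<^sup>2 *\<^sub>R V p
     - 2 *\<^sub>R (\<Sum>e\<in>Basis. (V p \<bullet> cov_deriv \<phi> e (tension \<phi>) p) *\<^sub>R pderiv_dir e \<phi> p)
     - 2 *\<^sub>R (\<Sum>e\<in>Basis. (tension \<phi> p \<bullet> cov_deriv \<phi> e V p) *\<^sub>R pderiv_dir e \<phi> p)
     - (tension \<phi> p \<bullet> V p) *\<^sub>R tension \<phi> p
     + trace_op \<phi> (rough_laplacian \<phi> V) p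
     + trace_op \<phi> (trace_op \<phi> V) p
     - (2 * normsq_d \<phi> p) *\<^sub>R trace_op \<phi> V p
     + (2 * inner_d \<phi> V p) *\<^sub>R tension \<phi> p
     - normsq_d \<phi> p *\<^sub>R rough_laplacian \<phi> V p
     + (normsq_d \<phi> p)\<^sup>2 *\<^sub>R V p"

definition eigenspace ::
    "(real \<times> real \<Rightarrow> 'b::euclidean_space) \<Rightarrow> real \<Rightarrow> (real \<times> real \<Rightarrow> 'b) set" where
  "eigenspace \<phi> \<mu> = {V \<in> sections \<phi>. \<forall>p. second_variation \<phi> V p = \<mu> *\<^sub>R V p}"

definition negative_eigenvalues :: "(real \<times> real \<Rightarrow> 'b::euclidean_space) \<Rightarrow> real set" where
  "negative_eigenvalues \<phi> = {\<mu>. \<mu> < 0 \<and> (\<exists>V\<in>eigenspace \<phi> \<mu>. V \<noteq> 0)}"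

text \<open>Infinitely many negative eigenvalues would make the index infinite, whereas a \<^const>\<open>sum\<close> over an
  infinite set is \<open>0\<close>.\<close>

definition bi_index :: "(real \<times> real \<Rightarrow> 'b::euclidean_space) \<Rightarrow> enat" where
  "bi_index \<phi> = (if finite (negative_eigenvalues \<phi>)
     then \<Sum>\<mu>\<in>negative_eigenvalues \<phi>. edim (eigenspace \<phi> \<mu>) else \<infinity>)"

definition bi_nullity :: "(real \<times> real \<Rightarrow> 'b::euclidean_space) \<Rightarrow> enat" where
  "bi_nullity \<phi> = edim {V \<in> sections \<phi>. \<forall>p. second_variation \<phi> V p = 0}"


section \<open>The maps \<open>\<phi>\<^sub>k\<close>\<close>

definition alpha_star :: real where
  "alpha_star = pi / 4"

definition phi :: "nat \<Rightarrow> real \<times> real \<Rightarrow> real ^ 3" where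
  "phi k = (\<lambda>(\<gamma>, \<theta>). vector [sin alpha_star * cos (real k * \<gamma>),
                              sin alpha_star * sin (real k * \<gamma>),
                              cos alpha_star])"

definition lambda_minus :: "nat \<Rightarrow> nat \<Rightarrow> nat \<Rightarrow> real" where
  "lambda_minus k' m' n' = (let k = real k'; m = real m'; n = real n' in
     1 / 2 * (- (k^4) + k^2 * (5 * m^2 + n^2) + 2 * (m^2 + n^2)^2
       - sqrt (k^8 + 2 * k^6 * (m^2 + n^2) + k^4 * (m^2 + n^2)^2
               + 32 * k^2 * m^2 * (m^2 + n^2)^2)))"

definition f_count :: "nat \<Rightarrow> nat" where
  "f_count k = card {(m, n). 1 \<le> m \<and> 1 \<le> n \<and> lambda_minus k m n < 0}"

definition g_count :: "nat \<Rightarrow> nat" where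
  "g_count k = card {(m, n). 1 \<le> m \<and> 1 \<le> n \<and> lambda_minus k m n = 0}"

end

theory Submission
  imports Defs
begin

text \<open>The pull-back bundle of \<open>\<phi>\<^sub>k\<close> has a global orthonormal frame \<open>X, Y\<close>: the unit tangent of the circle
  of latitude onto which \<open>\<phi>\<^sub>k\<close> maps, and the unit vector along the meridian. With \<open>c = k / \<surd>2\<close> one has
  \<open>d\<phi>(\<partial>\<^sub>\<gamma>) = c X\<close>, \<open>\<nabla>\<^sub>\<gamma> X = - c Y\<close>, \<open>\<nabla>\<^sub>\<gamma> Y = c X\<close> and \<open>\<tau>(\<phi>\<^sub>k) = - c\<^sup>2 Y\<close>, while every
  \<open>\<theta>\<close>-derivative of the frame vanishes. Hence for a section \<open>a X + b Y\<close> the operator \<open>I\<^sub>2\<close> is a linear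
  system with constant coefficients in the doubly periodic functions \<open>a, b\<close>
  (\<open>second_variation_frame\<close>), and Fourier analysis diagonalises it.

  A real form of the exponentials is convenient for this. Let \<open>hartley m n = cos s + sin s\<close> with
  \<open>s = m \<gamma> + n \<theta>\<close>. A derivative sends it to a multiple of the reflected function
  \<open>hartley (- m) (- n) = cos s - sin s\<close>. The terms of \<open>I\<^sub>2\<close> that couple \<open>a\<close> with \<open>b\<close> have odd order and
  the others even order; so, if \<open>a\<close> is tested against \<open>hartley m n\<close> and \<open>b\<close> against the reflected
  function, \<open>I\<^sub>2\<close> acts on each pair of coefficients by a real symmetric matrix \<open>(A q; q B)\<close>
  (\<open>second_variation_symmetric\<close>). Every \<open>(m, n) \<in> \<int>\<^sup>2\<close> contributes two eigenfunctions, whose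
  eigenvalues are the roots of the characteristic polynomial; the lower root is
  \<open>\<lambda>\<^sup>-\<close> at \<open>(\<bar>m\<bar>, \<bar>n\<bar>)\<close>. By the Stone--Weierstrass theorem the Hartley functions are complete
  (\<open>hartley_complete\<close>), so these eigenfunctions span all eigenspaces (\<open>eigenspace_eq_span\<close>), and index
  and nullity count the modes with negative and with zero eigenvalue.

  Away from the origin \<open>A > 0\<close>, so the upper root is positive and the lower root has the sign of
  \<open>A B - q\<^sup>2\<close>. This is the sign of \<open>\<bar>m\<bar> - k\<close> on the axis \<open>n = 0\<close> and of \<open>\<bar>n\<bar> - k\<close> on the axis
  \<open>m = 0\<close>. At the origin the roots are \<open>- k\<^sup>4\<close> and \<open>0\<close>. A pair \<open>m, n \<ge> 1\<close> stands for four points of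
  \<open>\<int>\<^sup>2\<close> and a point of a half-axis for two. Hence the nullity is \<open>1 + 2 + 2 + 4 g(k)\<close> and the index is
  \<open>1 + 2 (k - 1) + 2 (k - 1) + 4 f(k)\<close>.

  For biharmonicity, let \<open>\<tau>\<^sub>t\<close> be the tension field of a variation \<open>\<Phi>\<^sub>t\<close>. At \<open>t = 0\<close> the functions
  \<open>1/2 \<integral>\<bar>\<tau>\<^sub>t\<bar>\<^sup>2\<close> and \<open>\<integral>\<langle>\<tau>\<^sub>0, \<tau>\<^sub>t\<rangle>\<close> have the same derivative. In the second one the flat Laplacian of
  \<open>\<Phi>\<^sub>t\<close> can be moved to the fixed field \<open>\<tau>\<^sub>0\<close>, after which the \<open>t\<close>-derivative of the integrand
  at \<open>t = 0\<close> involves only the variation field \<open>U\<close>. Since the flat Laplacian of \<open>Y\<close> is \<open>- c\<^sup>2 (Y + \<phi>\<^sub>k)\<close> and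
  \<open>\<langle>U, \<phi>\<^sub>k\<rangle> = 0\<close>, that derivative vanishes at every point.\<close>


section \<open>Calculus of smooth functions\<close>

lemma C_k_continuous: "C_k n f \<Longrightarrow> continuous_on UNIV f"
  by (cases n) (auto simp: differentiable_imp_continuous_on)

lemma C_k_Suc_imp: "C_k (Suc n) f \<Longrightarrow> C_k n f"
proof (induction n arbitrary: f)
  case 0
  then show ?case by (simp add: differentiable_imp_continuous_on)
next
  case (Suc n)
  have "C_k n (\<lambda>x. frechet_derivative f (at x) v)" for v
    by (rule Suc.IH) (use Suc.prems in simp)
  then show ?case using Suc.prems by simp
qed

lemma C_k_SucI:
  assumes "\<And>x. (f has_derivative f' x) (at x)" and "\<And>v. C_k n (\<lambda>x. f' x v)"
  shows "C_k (Suc n) f"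
proof -
  have "frechet_derivative f (at x) = f' x" for x
    using frechet_derivative_at[OF assms(1)] by simp
  moreover have "f differentiable_on UNIV"
    using assms(1) by (auto simp: differentiable_on_def differentiable_def)
  ultimately show ?thesis using assms(2) by simp
qed

lemma C_k_Suc_has_derivative:
  assumes "C_k (Suc n) f"
  shows "(f has_derivative frechet_derivative f (at x)) (at x)"
  using assms by (simp add: differentiable_on_def frechet_derivative_works)

lemma C_k_add: "C_k n f \<Longrightarrow> C_k n g \<Longrightarrow> C_k n (\<lambda>x. f x + g x)"
proof (induction n arbitrary: f g)
  case 0
  then show ?case by (simp add: continuous_on_add)
next
  case (Suc n)
  note d = C_k_Suc_has_derivative[OF Suc.prems(1)] C_k_Suc_has_derivative[OF Suc.prems(2)]
  show ?case
    by (rule C_k_SucI[OF has_derivative_add[OF d]]) (use Suc in simp)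
qed

lemma C_k_bilinear:
  assumes "bounded_bilinear pr"
  shows "C_k n f \<Longrightarrow> C_k n g \<Longrightarrow> C_k n (\<lambda>x. pr (f x) (g x))"
proof (induction n arbitrary: f g)
  case 0
  then show ?case by (simp add: bounded_bilinear.continuous_on[OF assms])
next
  case (Suc n)
  note d = C_k_Suc_has_derivative[OF Suc.prems(1)] C_k_Suc_has_derivative[OF Suc.prems(2)]
  show ?case
    by (rule C_k_SucI[OF bounded_bilinear.FDERIV[OF assms d]])
       (intro C_k_add Suc.IH; use Suc.prems C_k_Suc_imp in auto)
qed

lemma C_k_affine_comp:
  assumes "bounded_linear l"
  shows "C_k n f \<Longrightarrow> C_k n (\<lambda>x. f (c + l x))"
proof (induction n arbitrary: f)
  case 0
  have "continuous_on UNIV (\<lambda>x. c + l x)"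
    by (intro continuous_intros linear_continuous_on assms)
  then show ?case
    using 0 by (auto intro!: continuous_on_compose2[of UNIV f])
next
  case (Suc n)
  have "((\<lambda>x. c + l x) has_derivative l) (at x)" for x
    using bounded_linear_imp_has_derivative[OF assms] by (auto intro!: derivative_eq_intros)
  from has_derivative_compose[OF this C_k_Suc_has_derivative[OF Suc.prems]]
  show ?case
  proof (rule C_k_SucI)
    show "C_k n (\<lambda>x. frechet_derivative f (at (c + l x)) (l v))" for v
      using Suc.IH[of "\<lambda>y. frechet_derivative f (at y) (l v)"] Suc.prems by simp
  qed
qed

lemma smooth_has_derivative:
  "smooth f \<Longrightarrow> (f has_derivative frechet_derivative f (at x)) (at x)"
  unfolding smooth_def by (metis C_k_Suc_has_derivative)

lemma smooth_continuous_on: "smooth f \<Longrightarrow> continuous_on S f"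
  unfolding smooth_def by (metis C_k_continuous continuous_on_subset top_greatest)

lemma smooth_frechet_derivative:
  "smooth f \<Longrightarrow> smooth (\<lambda>x. frechet_derivative f (at x) v)"
  unfolding smooth_def by (metis C_k.simps(2))

text \<open>Smoothness is coinductive: if each function of a class has a derivative whose values in fixed
  directions lie in the class again, then the class consists of smooth functions.\<close>

lemma smooth_coinduct:
  assumes "P f"
    and step: "\<And>f. P f \<Longrightarrow> \<exists>f'. (\<forall>x. (f has_derivative f' x) (at x)) \<and> (\<forall>v. P (\<lambda>x. f' x v))"
  shows "smooth f"
proof -
  have "P f \<Longrightarrow> C_k n f" for n f
  proof (induction n arbitrary: f)
    case 0
    then obtain f' where "\<And>x. (f has_derivative f' x) (at x)" using step by blast
    then show ?case
      by (auto intro!: has_derivative_continuous continuous_at_imp_continuous_on)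
  next
    case (Suc n)
    then obtain f' where "\<And>x. (f has_derivative f' x) (at x)" "\<And>v. P (\<lambda>x. f' x v)"
      using step by blast
    then show ?case using Suc.IH C_k_SucI by blast
  qed
  then show ?thesis using assms(1) by (simp add: smooth_def)
qed

lemma smooth_const: "smooth (\<lambda>x. c)"
  by (rule smooth_coinduct[where P = "\<lambda>f. \<exists>c. f = (\<lambda>x. c)"])
     (auto intro!: exI[where x = "\<lambda>_ _. 0"])

lemma smooth_add: "smooth f \<Longrightarrow> smooth g \<Longrightarrow> smooth (\<lambda>x. f x + g x)"
  by (simp add: smooth_def C_k_add)

lemma smooth_bilinear:
  "bounded_bilinear pr \<Longrightarrow> smooth f \<Longrightarrow> smooth g \<Longrightarrow> smooth (\<lambda>x. pr (f x) (g x))"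
  by (simp add: smooth_def C_k_bilinear)

lemmas smooth_mult = smooth_bilinear[OF bounded_bilinear_mult]
lemmas smooth_scaleR = smooth_bilinear[OF bounded_bilinear_scaleR]
lemmas smooth_inner = smooth_bilinear[OF bounded_bilinear_inner]

lemma smooth_uminus: "smooth f \<Longrightarrow> smooth (\<lambda>x. - f x)"
  using smooth_scaleR[OF smooth_const[of "-1"]] by fastforce

lemma smooth_diff: "smooth f \<Longrightarrow> smooth g \<Longrightarrow> smooth (\<lambda>x. f x - g x)"
  using smooth_add[OF _ smooth_uminus] by fastforce

lemma smooth_sum: "(\<And>i. i \<in> I \<Longrightarrow> smooth (f i)) \<Longrightarrow> smooth (\<lambda>x. \<Sum>i\<in>I. f i x)"
  by (induction I rule: infinite_finite_induct) (auto intro!: smooth_add smooth_const)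

lemma smooth_affine_comp:
  "bounded_linear l \<Longrightarrow> smooth f \<Longrightarrow> smooth (\<lambda>x. f (c + l x))"
  by (simp add: smooth_def C_k_affine_comp)

lemma frechet_derivative_bilinear:
  assumes "bounded_bilinear pr" "smooth f" "smooth g"
  shows "frechet_derivative (\<lambda>y. pr (f y) (g y)) (at x) v =
    pr (f x) (frechet_derivative g (at x) v) + pr (frechet_derivative f (at x) v) (g x)"
  using frechet_derivative_at[OF bounded_bilinear.FDERIV[OF assms(1)
      smooth_has_derivative[OF assms(2)] smooth_has_derivative[OF assms(3)]], of x] by metis

lemma frechet_derivative_diff:
  assumes "smooth f" "smooth g"
  shows "frechet_derivative (\<lambda>y. f y - g y) (at x) v =
    frechet_derivative f (at x) v - frechet_derivative g (at x) v"
  using frechet_derivative_at[OF has_derivative_diff[OF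
      smooth_has_derivative[OF assms(1)] smooth_has_derivative[OF assms(2)]], of x] by metis

lemma smooth_vector_3:
  fixes f g h :: "'a::euclidean_space \<Rightarrow> real"
  assumes "smooth f" "smooth g" "smooth h"
  shows "smooth (\<lambda>x. vector [f x, g x, h x] :: real^3)"
proof -
  have "(\<lambda>x. vector [f x, g x, h x] :: real^3) =
      (\<lambda>x. f x *\<^sub>R axis 1 1 + g x *\<^sub>R axis 2 1 + h x *\<^sub>R axis 3 1)"
    by (auto simp: vec_eq_iff forall_3 axis_def vector_3)
  then show ?thesis
    using assms by (auto intro!: smooth_add smooth_scaleR smooth_const)
qed

text \<open>The directional derivatives of a sinusoid are sinusoids with the same phase function, so coinduction
  applies.\<close>

lemma smooth_cos_sin_linear:
  fixes l :: "'a::euclidean_space \<Rightarrow> real"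
  assumes "bounded_linear l"
  shows "smooth (\<lambda>x. A * cos (l x) + B * sin (l x))"
proof (rule smooth_coinduct[where P = "\<lambda>f. \<exists>A B. f = (\<lambda>x. A * cos (l x) + B * sin (l x))"])
  fix f assume "\<exists>A B. f = (\<lambda>x. A * cos (l x) + B * sin (l x))"
  then obtain A B where f: "f = (\<lambda>x. A * cos (l x) + B * sin (l x))" by blast
  have l: "(l has_derivative l) (at x)" for x
    using assms by (rule bounded_linear_imp_has_derivative)
  have "(f has_derivative (\<lambda>v. (l v * B) * cos (l x) + (- l v * A) * sin (l x))) (at x)" for x
    unfolding f by (auto intro!: derivative_eq_intros l simp: algebra_simps)
  moreover have "\<exists>A' B'. (\<lambda>x. (l v * B) * cos (l x) + (- l v * A) * sin (l x)) =
      (\<lambda>x. A' * cos (l x) + B' * sin (l x))" for v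
    by blast
  ultimately show "\<exists>f'. (\<forall>x. (f has_derivative f' x) (at x)) \<and>
      (\<forall>v. \<exists>A B. (\<lambda>x. f' x v) = (\<lambda>x. A * cos (l x) + B * sin (l x)))"
    by (intro exI[where x = "\<lambda>x v. (l v * B) * cos (l x) + (- l v * A) * sin (l x)"]) blast
qed blast

lemma pderiv_dir_eqI: "(f has_derivative f') (at p) \<Longrightarrow> pderiv_dir e f p = f' e"
  unfolding pderiv_dir_def by (metis frechet_derivative_at)

lemma smooth_pderiv_dir: "smooth f \<Longrightarrow> smooth (pderiv_dir e f)"
  unfolding pderiv_dir_def by (rule smooth_frechet_derivative)

lemma smooth_has_pderiv: "smooth f \<Longrightarrow> (f has_derivative (\<lambda>e. pderiv_dir e f p)) (at p)"
  unfolding pderiv_dir_def by (simp add: smooth_has_derivative)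

lemma pderiv_dir_bilinear:
  assumes "bounded_bilinear pr" "smooth f" "smooth g"
  shows "pderiv_dir e (\<lambda>q. pr (f q) (g q)) p = pr (f p) (pderiv_dir e g p) + pr (pderiv_dir e f p) (g p)"
  using frechet_derivative_bilinear[OF assms] by (simp add: pderiv_dir_def)

lemma pderiv_dir_const: "pderiv_dir e (\<lambda>q. c) = (\<lambda>p. 0)"
  using pderiv_dir_eqI[OF has_derivative_const] by blast

lemma pderiv_dir_add:
  assumes "smooth f" "smooth g"
  shows "pderiv_dir e (\<lambda>q. f q + g q) = (\<lambda>p. pderiv_dir e f p + pderiv_dir e g p)"
  using pderiv_dir_eqI[OF has_derivative_add[OF smooth_has_pderiv[OF assms(1)] smooth_has_pderiv[OF assms(2)]]]
  by blast

lemma pderiv_dir_scaleR: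
  assumes "smooth f"
  shows "pderiv_dir e (\<lambda>q. c *\<^sub>R f q) = (\<lambda>p. c *\<^sub>R pderiv_dir e f p)"
  using pderiv_dir_bilinear[OF bounded_bilinear_scaleR smooth_const assms, of e c]
  by (simp add: pderiv_dir_const fun_eq_iff)

lemma pderiv_dir_cmult:
  fixes f :: "real \<times> real \<Rightarrow> real"
  assumes "smooth f"
  shows "pderiv_dir e (\<lambda>q. c * f q) = (\<lambda>p. c * pderiv_dir e f p)"
  using pderiv_dir_scaleR[OF assms] by simp

lemma pderiv_dir_diff:
  fixes f g :: "real \<times> real \<Rightarrow> real"
  assumes "smooth f" "smooth g"
  shows "pderiv_dir e (\<lambda>q. f q - g q) = (\<lambda>p. pderiv_dir e f p - pderiv_dir e g p)"
  using pderiv_dir_add[OF assms(1) smooth_uminus[OF assms(2)], of e] pderiv_dir_cmult[OF assms(2), of e "- 1"]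
  by simp


section \<open>Periodic functions on the plane\<close>

lemma torus_periodic_shift:
  assumes "torus_periodic f"
  shows "f (p + (2 * pi, 0)) = f p" "f (p + (0, 2 * pi)) = f p"
  using assms by (cases p; simp add: torus_periodic_def)+

lemma torus_periodic_pderiv_dir:
  assumes "smooth f" "torus_periodic f"
  shows "torus_periodic (pderiv_dir e f)"
proof -
  have shift: "pderiv_dir e f (p + s) = pderiv_dir e f p" if "\<And>q. f (q + s) = f q" for s p
  proof -
    have "((\<lambda>q. q + s) has_derivative (\<lambda>x. x)) (at p)"
      by (auto intro!: derivative_eq_intros)
    from has_derivative_compose[OF this smooth_has_pderiv[OF assms(1), of "p + s"]]
    have "(f has_derivative (\<lambda>x. pderiv_dir x f (p + s))) (at p)"
      using that by simp
    then show ?thesis by (metis pderiv_dir_eqI)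
  qed
  show ?thesis
    using shift[OF torus_periodic_shift(1)[OF assms(2)]] shift[OF torus_periodic_shift(2)[OF assms(2)]]
    by (fastforce simp: torus_periodic_def)
qed

lemma torus_periodic_int:
  assumes "torus_periodic f"
  shows "f (x + 2 * pi * of_int i, y + 2 * pi * of_int j) = f (x, y)"
proof -
  have per: "g (x + 2 * pi * of_int i) = g x" if "\<And>x. g (x + 2 * pi) = g x" for g :: "real \<Rightarrow> 'a" and x i
  proof (induction i rule: int_induct[where k = 0])
    case (step1 i)
    then show ?case using that[of "x + 2 * pi * of_int i"] by (simp add: algebra_simps)
  next
    case (step2 i)
    then show ?case using that[of "x + 2 * pi * of_int (i - 1)"] by (simp add: algebra_simps)
  qed simp
  show ?thesis
    using per[of "\<lambda>x. f (x, y + 2 * pi * of_int j)" x i] per[of "\<lambda>y. f (x, y)" y j] assms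
    by (simp add: torus_periodic_def)
qed


section \<open>Integration over the torus\<close>

definition torus_integral :: "(real \<times> real \<Rightarrow> real) \<Rightarrow> real" where
  "torus_integral f = integral (cbox (0, 0) (2 * pi, 2 * pi)) f"

lemma continuous_torus_integrable:
  fixes f :: "real \<times> real \<Rightarrow> real"
  assumes "continuous_on UNIV f"
  shows "f integrable_on cbox (0, 0) (2 * pi, 2 * pi)"
  using assms continuous_on_subset integrable_continuous by blast

lemma torus_integral_add:
  "continuous_on UNIV f \<Longrightarrow> continuous_on UNIV g \<Longrightarrow>
    torus_integral (\<lambda>p. f p + g p) = torus_integral f + torus_integral g"
  unfolding torus_integral_def by (intro integral_add continuous_torus_integrable)

lemma torus_integral_diff:
  "continuous_on UNIV f \<Longrightarrow> continuous_on UNIV g \<Longrightarrow>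
    torus_integral (\<lambda>p. f p - g p) = torus_integral f - torus_integral g"
  unfolding torus_integral_def by (intro integral_diff continuous_torus_integrable)

lemma torus_integral_cmult: "torus_integral (\<lambda>p. c * f p) = c * torus_integral f"
  unfolding torus_integral_def by simp

text \<open>By the fundamental theorem of calculus the integral of \<open>\<partial> f\<close> over a full period in the direction of
  differentiation vanishes; Fubini's theorem lets this direction be integrated first.\<close>

lemma torus_integral_pderiv_dir:
  fixes f :: "real \<times> real \<Rightarrow> real"
  assumes "smooth f" "torus_periodic f" "e \<in> Basis"
  shows "torus_integral (pderiv_dir e f) = 0"
proof -
  let ?I = "cbox 0 (2 * pi)"
  have cont: "continuous_on S (pderiv_dir e f)" for S e
    by (intro smooth_continuous_on smooth_pderiv_dir assms)
  have "((\<lambda>x. (x, y)) has_derivative (\<lambda>h. (h, 0))) (at x)"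
    "((\<lambda>y. (x, y)) has_derivative (\<lambda>h. (0, h))) (at y)" for x y :: real
    by (auto intro!: derivative_eq_intros)
  note d = this[THEN has_derivative_compose, OF smooth_has_pderiv[OF assms(1)]]
  have lin: "pderiv_dir (h *\<^sub>R v) f p = h * pderiv_dir v f p" for h v p
    using linear_scale[OF has_derivative_linear[OF smooth_has_pderiv[OF assms(1)]]]
    by simp
  have scl: "(\<lambda>h. h *\<^sub>R pderiv_dir (1, 0) f p) = (\<lambda>h. pderiv_dir (h, 0) f p)"
    "(\<lambda>h. h *\<^sub>R pderiv_dir (0, 1) f p) = (\<lambda>h. pderiv_dir (0, h) f p)" for p
    by (simp_all add: lin[symmetric] fun_eq_iff)
  have "((\<lambda>x. f (x, y)) has_vector_derivative pderiv_dir (1, 0) f (x, y)) (at x)"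
    "((\<lambda>y. f (x, y)) has_vector_derivative pderiv_dir (0, 1) f (x, y)) (at y)" for x y
    unfolding has_vector_derivative_def scl using d(1)[of y x] d(2)[of x y] by auto
  note fd = this[THEN has_vector_derivative_at_within]
  have "((\<lambda>x. pderiv_dir (1, 0) f (x, y)) has_integral f (2 * pi, y) - f (0, y)) {0..2 * pi}"
    "((\<lambda>y. pderiv_dir (0, 1) f (x, y)) has_integral f (x, 2 * pi) - f (x, 0)) {0..2 * pi}" for x y
    by (rule fundamental_theorem_of_calculus[of 0 "2 * pi" "\<lambda>x. f (x, y)"], simp, rule fd)
       (rule fundamental_theorem_of_calculus[of 0 "2 * pi" "\<lambda>y. f (x, y)"], simp, rule fd)
  moreover have "f (2 * pi, y) = f (0, y)" "f (x, 2 * pi) = f (x, 0)" for x y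
    using torus_periodic_shift[OF assms(2), of "(0, y)"] torus_periodic_shift[OF assms(2), of "(x, 0)"]
    by simp_all
  ultimately have inner: "integral ?I (\<lambda>x. pderiv_dir (1, 0) f (x, y)) = 0"
    "integral ?I (\<lambda>y. pderiv_dir (0, 1) f (x, y)) = 0" for x y
    unfolding cbox_interval by (metis integral_unique diff_self)+
  have "integral ?I (\<lambda>x. integral ?I (\<lambda>y. pderiv_dir (1, 0) f (x, y))) = 0"
    using integral_swap_continuous[of 0 0 "2 * pi" "2 * pi" "\<lambda>x y. pderiv_dir (1, 0) f (x, y)"]
    using inner(1) by (simp add: cont)
  moreover have "integral ?I (\<lambda>x. integral ?I (\<lambda>y. pderiv_dir (0, 1) f (x, y))) = 0"
    using inner(2) by simp
  moreover have "e = (1, 0) \<or> e = (0, 1)"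
    using assms(3) by (auto simp: Basis_prod_def)
  moreover have "torus_integral (pderiv_dir e f) = integral ?I (\<lambda>x. integral ?I (\<lambda>y. pderiv_dir e f (x, y)))" for e
    unfolding torus_integral_def by (rule integral_prod_continuous[OF cont])
  ultimately show ?thesis by (elim disjE) (simp_all only:)
qed

lemma torus_periodic_comp2:
  "torus_periodic f \<Longrightarrow> torus_periodic g \<Longrightarrow> torus_periodic (\<lambda>p. h (f p) (g p))"
  by (simp add: torus_periodic_def)

lemma torus_integral_by_parts:
  fixes f g :: "real \<times> real \<Rightarrow> 'a::euclidean_space"
  assumes "smooth f" "smooth g" "torus_periodic f" "torus_periodic g" "e \<in> Basis"
  shows "torus_integral (\<lambda>p. pderiv_dir e f p \<bullet> g p) = - torus_integral (\<lambda>p. f p \<bullet> pderiv_dir e g p)"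
proof -
  have "0 = torus_integral (pderiv_dir e (\<lambda>p. f p \<bullet> g p))"
    by (rule torus_integral_pderiv_dir[symmetric])
       (intro smooth_inner torus_periodic_comp2[where h = inner] assms)+
  also have "pderiv_dir e (\<lambda>p. f p \<bullet> g p) = (\<lambda>p. f p \<bullet> pderiv_dir e g p + pderiv_dir e f p \<bullet> g p)"
    by (intro ext pderiv_dir_bilinear bounded_bilinear_inner assms)
  also have "torus_integral \<dots> =
      torus_integral (\<lambda>p. f p \<bullet> pderiv_dir e g p) + torus_integral (\<lambda>p. pderiv_dir e f p \<bullet> g p)"
    by (intro torus_integral_add smooth_continuous_on smooth_inner smooth_pderiv_dir assms)
  finally show ?thesis by simp
qed

lemma torus_integral_has_derivative:
  fixes G :: "real \<times> real \<times> real \<Rightarrow> real"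
  assumes "smooth G"
  shows "((\<lambda>t. torus_integral (\<lambda>p. G (t, p))) has_real_derivative
    torus_integral (\<lambda>p. frechet_derivative G (at (t, p)) (1, 0))) (at t)"
proof -
  have "((\<lambda>t. G (t, p)) has_real_derivative frechet_derivative G (at (t, p)) (1, 0)) (at t)" for t p
  proof -
    have "((\<lambda>t. (t, p)) has_derivative (\<lambda>h. (h, 0))) (at t)"
      by (auto intro!: derivative_eq_intros)
    from has_derivative_compose[OF this smooth_has_derivative[OF assms]]
    have "((\<lambda>t. G (t, p)) has_derivative (\<lambda>h. frechet_derivative G (at (t, p)) (h, 0))) (at t)" .
    moreover have "(*) (frechet_derivative G (at (t, p)) (1, 0)) = (\<lambda>h. frechet_derivative G (at (t, p)) (h, 0))"
      using linear_scale[OF has_derivative_linear[OF smooth_has_derivative[OF assms, of "(t, p)"]], of _ "(1, 0)", symmetric]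
      by (simp add: mult.commute fun_eq_iff)
    ultimately show ?thesis unfolding has_field_derivative_def by simp
  qed
  moreover have "(\<lambda>p. G (t, p)) integrable_on cbox (0, 0) (2 * pi, 2 * pi)" for t
    by (intro continuous_torus_integrable continuous_on_compose2[OF smooth_continuous_on[OF assms]])
       (auto intro!: continuous_intros)
  moreover have "continuous_on (UNIV \<times> cbox (0, 0) (2 * pi, 2 * pi))
      (\<lambda>(t, p). frechet_derivative G (at (t, p)) (1, 0))"
    using smooth_continuous_on[OF smooth_frechet_derivative[OF assms, of "(1, 0)"]]
    by (simp add: case_prod_beta)
  ultimately show ?thesis
    unfolding torus_integral_def
    by (rule leibniz_rule_field_derivative[where U = UNIV and f = "\<lambda>t p. G (t, p)"
          and fx = "\<lambda>t p. frechet_derivative G (at (t, p)) (1, 0)"])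
       (simp_all only: UNIV_I convex_UNIV)
qed


section \<open>Hartley series on the torus\<close>

text \<open>This is the function \<open>cas\<close> of Hartley transforms. Indexed by all of \<open>\<int>\<^sup>2\<close> it gives a real orthogonal
  basis with one function for each frequency, so no case distinction between sines and cosines is
  needed.\<close>

definition hartley :: "int \<Rightarrow> int \<Rightarrow> real \<times> real \<Rightarrow> real" where
  "hartley m n = (\<lambda>(x, y). cos (of_int m * x + of_int n * y) + sin (of_int m * x + of_int n * y))"

definition hartley_coeff :: "int \<Rightarrow> int \<Rightarrow> (real \<times> real \<Rightarrow> real) \<Rightarrow> real" where
  "hartley_coeff m n f = torus_integral (\<lambda>p. f p * hartley m n p)"

lemma hartley_0 [simp]: "hartley 0 0 p = 1"
  by (simp add: hartley_def case_prod_beta)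

lemma hartley_uminus:
  "hartley (- m) (- n) (x, y) = cos (of_int m * x + of_int n * y) - sin (of_int m * x + of_int n * y)"
proof -
  have "of_int (- m) * x + of_int (- n) * y = - (of_int m * x + of_int n * y)" by simp
  then show ?thesis by (simp only: hartley_def prod.case cos_minus sin_minus)
qed

lemma hartley_has_derivative:
  "(hartley m n has_derivative (\<lambda>(u, v). (of_int m * u + of_int n * v) * hartley (- m) (- n) p)) (at p)"
proof (cases p)
  case (Pair x y)
  have "((\<lambda>q. cos (of_int m * fst q + of_int n * snd q) + sin (of_int m * fst q + of_int n * snd q))
      has_derivative (\<lambda>q. (of_int m * fst q + of_int n * snd q) *
        (cos (of_int m * x + of_int n * y) - sin (of_int m * x + of_int n * y)))) (at (x, y))"
    by (auto intro!: derivative_eq_intros simp: algebra_simps)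
  then show ?thesis
    unfolding Pair hartley_uminus by (simp add: hartley_def case_prod_unfold)
qed

lemma smooth_hartley: "smooth (hartley m n)"
proof -
  have "bounded_linear (\<lambda>p. of_int m * fst p + of_int n * snd p :: real)"
    by (intro bounded_linear_intros)
  from smooth_cos_sin_linear[OF this, of 1 1] show ?thesis
    by (simp add: hartley_def case_prod_unfold)
qed

lemma torus_periodic_hartley: "torus_periodic (hartley m n)"
proof -
  have "cos (s + of_int j * (2 * pi)) = cos s \<and> sin (s + of_int j * (2 * pi)) = sin s" for s j
    using sin_cos_eq_iff[of "s + of_int j * (2 * pi)" s] by (auto simp: mult.commute)
  then have "cos (s + of_int j * (2 * pi)) + sin (s + of_int j * (2 * pi)) = cos s + sin s" for s j
    by simp
  from this[of "of_int m * _ + of_int n * _"] show ?thesis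
    unfolding torus_periodic_def hartley_def by (simp add: distrib_left add_ac)
qed

lemma pderiv_dir_hartley:
  "pderiv_dir (1, 0) (hartley m n) p = of_int m * hartley (- m) (- n) p"
  "pderiv_dir (0, 1) (hartley m n) p = of_int n * hartley (- m) (- n) p"
  by (simp_all add: pderiv_dir_eqI[OF hartley_has_derivative])

lemma in_Basis_plane: "(1, 0) \<in> (Basis :: (real \<times> real) set)" "(0, 1) \<in> (Basis :: (real \<times> real) set)"
  by (auto simp: Basis_prod_def)

text \<open>With phases \<open>s, t\<close> the product is \<open>cos (s - t) + sin (s + t)\<close>, and \<open>cos\<close>, \<open>sin\<close> are half the sum and
  half the difference of a Hartley function and its reflection.\<close>

lemma hartley_mult:
  "hartley m n p * hartley m' n' p =
    1 / 2 * (hartley (m - m') (n - n') p + hartley (m' - m) (n' - n) p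
      + hartley (m + m') (n + n') p - hartley (- m - m') (- n - n') p)"
proof (cases p)
  case (Pair x y)
  have "hartley i j p = (cos s + sin s) \<and> hartley (- i) (- j) p = (cos s - sin s)"
    if "s = of_int i * x + of_int j * y" for i j s
    unfolding Pair hartley_uminus that by (simp add: hartley_def)
  note h = this
  define s t where "s = of_int m * x + of_int n * y" and "t = of_int m' * x + of_int n' * y"
  have "hartley m n p = cos s + sin s" "hartley m' n' p = cos t + sin t"
    "hartley (m - m') (n - n') p = cos (s - t) + sin (s - t)"
    "hartley (m' - m) (n' - n) p = cos (s - t) - sin (s - t)"
    "hartley (m + m') (n + n') p = cos (s + t) + sin (s + t)"
    "hartley (- m - m') (- n - n') p = cos (s + t) - sin (s + t)"
    using h[of s m n] h[of t m' n'] h[of "s - t" "m - m'" "n - n'"] h[of "s + t" "m + m'" "n + n'"]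
    by (auto simp: s_def t_def algebra_simps)
  then show ?thesis
    by (simp add: cos_add sin_add cos_diff sin_diff algebra_simps)
qed

text \<open>For a nonzero frequency the function is itself a derivative of a periodic function.\<close>

lemma torus_integral_hartley:
  "torus_integral (hartley m n) = (if m = 0 \<and> n = 0 then (2 * pi)\<^sup>2 else 0)"
proof -
  have "c * torus_integral (hartley (- m) (- n)) = 0"
    if "e \<in> Basis" "\<And>p. pderiv_dir e (hartley m n) p = c * hartley (- m) (- n) p" for e c m n
    using torus_integral_pderiv_dir[OF smooth_hartley torus_periodic_hartley that(1), of m n]
    unfolding that(2)[abs_def] torus_integral_cmult .
  from this[OF in_Basis_plane(1), of "- m" "- n" "of_int (- m)"]
    this[OF in_Basis_plane(2), of "- m" "- n" "of_int (- n)"]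
  have "m \<noteq> 0 \<or> n \<noteq> 0 \<Longrightarrow> torus_integral (hartley m n) = 0"
    by (auto simp: pderiv_dir_hartley)
  moreover have "torus_integral (hartley 0 0) = (2 * pi)\<^sup>2"
  proof -
    have "hartley 0 0 = (\<lambda>p. 1)" by auto
    then show ?thesis
      by (simp add: torus_integral_def content_Pair power2_eq_square)
  qed
  ultimately show ?thesis by auto
qed

lemma hartley_coeff_add:
  "continuous_on UNIV f \<Longrightarrow> continuous_on UNIV g \<Longrightarrow>
    hartley_coeff m n (\<lambda>p. f p + g p) = hartley_coeff m n f + hartley_coeff m n g"
  unfolding hartley_coeff_def distrib_right
  by (intro torus_integral_add continuous_on_mult smooth_continuous_on[OF smooth_hartley])

lemma hartley_coeff_cmult: "hartley_coeff m n (\<lambda>p. c * f p) = c * hartley_coeff m n f"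
  unfolding hartley_coeff_def by (simp add: mult.assoc torus_integral_cmult)

lemma hartley_coeff_diff:
  assumes "continuous_on UNIV f" "continuous_on UNIV g"
  shows "hartley_coeff m n (\<lambda>p. f p - g p) = hartley_coeff m n f - hartley_coeff m n g"
  using hartley_coeff_add[OF assms(1), of "\<lambda>p. - 1 * g p" m n] hartley_coeff_cmult[of m n "- 1" g]
  by (simp add: continuous_on_minus assms)

lemma hartley_coeff_hartley:
  "hartley_coeff m n (hartley m' n') = (if m = m' \<and> n = n' then (2 * pi)\<^sup>2 else 0)"
proof -
  have c: "continuous_on UNIV (hartley i j)" for i j
    by (rule smooth_continuous_on[OF smooth_hartley])
  have "hartley_coeff m n (hartley m' n') = 1 / 2 *
    (torus_integral (hartley (m' - m) (n' - n)) + torus_integral (hartley (m - m') (n - n'))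
      + torus_integral (hartley (m' + m) (n' + n)) - torus_integral (hartley (- m' - m) (- n' - n)))"
    unfolding hartley_coeff_def hartley_mult torus_integral_cmult
    by (subst torus_integral_diff torus_integral_add, (intro continuous_intros c)+)+ simp
  moreover have "- i - j = 0 \<longleftrightarrow> i + j = 0" for i j :: int by auto
  ultimately show ?thesis by (simp add: torus_integral_hartley) auto
qed

text \<open>\<open>\<partial> hartley m n\<close> is a multiple of the reflected function \<open>hartley (- m) (- n)\<close>, so a derivative
  exchanges a coefficient with the reflected one.\<close>

lemma hartley_coeff_pderiv_dir:
  fixes f :: "real \<times> real \<Rightarrow> real"
  assumes "smooth f" "torus_periodic f"
  shows "hartley_coeff m n (pderiv_dir (1, 0) f) = - of_int m * hartley_coeff (- m) (- n) f"
    and "hartley_coeff m n (pderiv_dir (0, 1) f) = - of_int n * hartley_coeff (- m) (- n) f"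
proof -
  note parts = torus_integral_by_parts[OF assms(1) smooth_hartley assms(2) torus_periodic_hartley]
  have "(\<lambda>p. f p * (c * g p)) = (\<lambda>p. c * (f p * g p))" for c :: real and g by auto
  then show "hartley_coeff m n (pderiv_dir (1, 0) f) = - of_int m * hartley_coeff (- m) (- n) f"
    "hartley_coeff m n (pderiv_dir (0, 1) f) = - of_int n * hartley_coeff (- m) (- n) f"
    using parts[OF in_Basis_plane(1), of m n] parts[OF in_Basis_plane(2), of m n]
    by (simp_all add: hartley_coeff_def pderiv_dir_hartley torus_integral_cmult)
qed

lemma cos_sin_mult_hartley:
  "cos x * hartley m n (x, y) = 1 / 2 * (hartley (m + 1) n (x, y) + hartley (m - 1) n (x, y))"
  "sin x * hartley m n (x, y) = 1 / 2 * (hartley (1 - m) (- n) (x, y) - hartley (- m - 1) (- n) (x, y))"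
  "cos y * hartley m n (x, y) = 1 / 2 * (hartley m (n + 1) (x, y) + hartley m (n - 1) (x, y))"
  "sin y * hartley m n (x, y) = 1 / 2 * (hartley (- m) (1 - n) (x, y) - hartley (- m) (- n - 1) (x, y))"
proof -
  define s where "s = of_int m * x + of_int n * y"
  have h: "hartley i j (x, y) = cos t + sin t" if "of_int i * x + of_int j * y = t" for i j t
    using that by (simp add: hartley_def)
  have "hartley m n (x, y) = cos s + sin s"
    "hartley (m + 1) n (x, y) = cos (s + x) + sin (s + x)"
    "hartley (m - 1) n (x, y) = cos (s - x) + sin (s - x)"
    "hartley (1 - m) (- n) (x, y) = cos (x - s) + sin (x - s)"
    "hartley (- m - 1) (- n) (x, y) = cos (- (s + x)) + sin (- (s + x))"
    "hartley m (n + 1) (x, y) = cos (s + y) + sin (s + y)"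
    "hartley m (n - 1) (x, y) = cos (s - y) + sin (s - y)"
    "hartley (- m) (1 - n) (x, y) = cos (y - s) + sin (y - s)"
    "hartley (- m) (- n - 1) (x, y) = cos (- (s + y)) + sin (- (s + y))"
    by (rule h, simp add: s_def algebra_simps)+
  then show "cos x * hartley m n (x, y) = 1 / 2 * (hartley (m + 1) n (x, y) + hartley (m - 1) n (x, y))"
    "sin x * hartley m n (x, y) = 1 / 2 * (hartley (1 - m) (- n) (x, y) - hartley (- m - 1) (- n) (x, y))"
    "cos y * hartley m n (x, y) = 1 / 2 * (hartley m (n + 1) (x, y) + hartley m (n - 1) (x, y))"
    "sin y * hartley m n (x, y) = 1 / 2 * (hartley (- m) (1 - n) (x, y) - hartley (- m) (- n - 1) (x, y))"
    unfolding cos_minus sin_minus cos_add sin_add cos_diff sin_diff by (simp_all only: algebra_simps)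
qed

text \<open>The continuous functions without Hartley coefficients form a module over the polynomials in
  \<open>cos x, sin x, cos y, sin y\<close>, since multiplication by these four functions maps a Hartley function
  to a combination of two others. This closure under multiplication is what an induction over
  polynomials needs: orthogonality to each of two factors would say nothing about their product.\<close>

definition hartley_null :: "(real \<times> real \<Rightarrow> real) \<Rightarrow> bool" where
  "hartley_null f \<longleftrightarrow> continuous_on UNIV f \<and> (\<forall>m n. hartley_coeff m n f = 0)"

lemma hartley_null_add: "hartley_null f \<Longrightarrow> hartley_null g \<Longrightarrow> hartley_null (\<lambda>p. f p + g p)"
  by (simp add: hartley_null_def hartley_coeff_add continuous_on_add)

lemma hartley_null_cmult: "hartley_null f \<Longrightarrow> hartley_null (\<lambda>p. f p * c)"
  unfolding mult.commute[of _ c]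
  by (simp add: hartley_null_def hartley_coeff_cmult continuous_intros)

lemma hartley_null_mult_generator:
  assumes "hartley_null f" and "continuous_on UNIV g"
    and g: "\<And>m n. \<exists>i j i' j' c. \<forall>p. g p * hartley m n p = 1 / 2 * (hartley i j p + c * hartley i' j' p)"
  shows "hartley_null (\<lambda>p. f p * g p)"
  unfolding hartley_null_def
proof (intro conjI allI)
  show "continuous_on UNIV (\<lambda>p. f p * g p)"
    using assms by (auto simp: hartley_null_def intro: continuous_on_mult)
next
  fix m n
  obtain i j i' j' c where "\<And>p. g p * hartley m n p = 1 / 2 * (hartley i j p + c * hartley i' j' p)"
    using g[of m n] by blast
  then have "(\<lambda>p. f p * g p * hartley m n p) =
      (\<lambda>p. 1 / 2 * (f p * hartley i j p + c * (f p * hartley i' j' p)))"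
    by (auto simp: mult.assoc algebra_simps)
  moreover have "continuous_on UNIV (\<lambda>p. f p * hartley i j p)" for i j
    using assms(1) by (auto simp: hartley_null_def intro!: continuous_on_mult smooth_continuous_on[OF smooth_hartley])
  ultimately have "hartley_coeff m n (\<lambda>p. f p * g p) = 1 / 2 * (hartley_coeff i j f + c * hartley_coeff i' j' f)"
    unfolding hartley_coeff_def
    by (simp only: torus_integral_cmult torus_integral_add continuous_on_mult_const continuous_on_mult_left)
  then show "hartley_coeff m n (\<lambda>p. f p * g p) = 0"
    using assms(1) by (simp add: hartley_null_def)
qed

text \<open>On the compact image of this map the polynomials in the real coordinates of \<open>\<complex> \<times> \<complex>\<close> become
  trigonometric polynomials.\<close>

definition torus_embed :: "real \<times> real \<Rightarrow> complex \<times> complex" where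
  "torus_embed p = (cis (fst p), cis (snd p))"

lemma continuous_on_torus_embed: "continuous_on S torus_embed"
  unfolding torus_embed_def by (intro continuous_intros)

lemma hartley_null_mult_linear:
  fixes l :: "complex \<times> complex \<Rightarrow> real"
  assumes "bounded_linear l" "hartley_null f"
  shows "hartley_null (\<lambda>p. f p * l (torus_embed p))"
proof -
  have lin: "l (z, w) = Re z * l (1, 0) + Im z * l (\<i>, 0) + (Re w * l (0, 1) + Im w * l (0, \<i>))" for z w
  proof -
    have "(z, w) = Re z *\<^sub>R (1, 0) + Im z *\<^sub>R (\<i>, 0) + (Re w *\<^sub>R (0, 1) + Im w *\<^sub>R (0, \<i>))"
      by (simp add: complex_eq_iff)
    then show ?thesis
      by (subst \<open>(z, w) = _\<close>) (simp only: linear_add[OF bounded_linear.linear[OF assms(1)]]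
        linear_scale[OF bounded_linear.linear[OF assms(1)]] real_scaleR_def)
  qed
  have l: "(\<lambda>p. f p * l (torus_embed p)) =
      (\<lambda>p. (f p * cos (fst p) * l (1, 0) + f p * sin (fst p) * l (\<i>, 0))
        + (f p * cos (snd p) * l (0, 1) + f p * sin (snd p) * l (0, \<i>)))"
    by (simp add: torus_embed_def lin[of "cis _" "cis _"] fun_eq_iff algebra_simps)
  have "\<exists>i j i' j' c. \<forall>p. cos (fst p) * hartley m n p = 1 / 2 * (hartley i j p + c * hartley i' j' p)"
    "\<exists>i j i' j' c. \<forall>p. sin (fst p) * hartley m n p = 1 / 2 * (hartley i j p + c * hartley i' j' p)"
    "\<exists>i j i' j' c. \<forall>p. cos (snd p) * hartley m n p = 1 / 2 * (hartley i j p + c * hartley i' j' p)"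
    "\<exists>i j i' j' c. \<forall>p. sin (snd p) * hartley m n p = 1 / 2 * (hartley i j p + c * hartley i' j' p)"
    for m n
    by (rule exI[of _ "m + 1"], rule exI[of _ n], rule exI[of _ "m - 1"], rule exI[of _ n], rule exI[of _ 1],
        simp add: split_paired_All cos_sin_mult_hartley)
      (rule exI[of _ "1 - m"], rule exI[of _ "- n"], rule exI[of _ "- m - 1"], rule exI[of _ "- n"], rule exI[of _ "- 1"],
        simp add: split_paired_All cos_sin_mult_hartley,
       rule exI[of _ m], rule exI[of _ "n + 1"], rule exI[of _ m], rule exI[of _ "n - 1"], rule exI[of _ 1],
        simp add: split_paired_All cos_sin_mult_hartley,
       rule exI[of _ "- m"], rule exI[of _ "1 - n"], rule exI[of _ "- m"], rule exI[of _ "- n - 1"], rule exI[of _ "- 1"],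
        simp add: split_paired_All cos_sin_mult_hartley)
  note gen = this[THEN hartley_null_mult_generator[OF assms(2), rotated]]
  have gen: "hartley_null (\<lambda>p. f p * cos (fst p))" "hartley_null (\<lambda>p. f p * sin (fst p))"
    "hartley_null (\<lambda>p. f p * cos (snd p))" "hartley_null (\<lambda>p. f p * sin (snd p))"
    by (rule gen, intro continuous_intros)+
  show ?thesis
    unfolding l by (intro hartley_null_add hartley_null_cmult gen)
qed

lemma hartley_null_mult_polynomial:
  assumes "real_polynomial_function P" "hartley_null f"
  shows "hartley_null (\<lambda>p. f p * P (torus_embed p))"
  using assms
proof (induction P arbitrary: f)
  case (linear l)
  then show ?case by (rule hartley_null_mult_linear)
next
  case (const c)
  then show ?case by (rule hartley_null_cmult)
next
  case (add P Q)
  then show ?case using hartley_null_add by (simp add: distrib_left)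
next
  case (mult P Q)
  from mult.IH(2)[OF mult.IH(1)[OF mult.prems]] show ?case
    by (simp add: mult.assoc)
qed

text \<open>A function of the arguments of \<open>z\<close> and \<open>w\<close> has to be shown continuous on the product of the circles
  although \<open>Arg2pi\<close> jumps. The preimage of a closed set under it is the image, under the
  continuous map \<open>torus_embed\<close>, of a compact part of the period square, hence closed.\<close>

lemma torus_periodic_factor:
  fixes f :: "real \<times> real \<Rightarrow> real"
  assumes "continuous_on UNIV f" "torus_periodic f"
  obtains F where "continuous_on (sphere 0 1 \<times> sphere 0 1) F" "\<And>p. F (torus_embed p) = f p"
proof -
  define F where "F zw = f (Arg2pi (fst zw), Arg2pi (snd zw))" for zw
  let ?K = "sphere 0 1 \<times> sphere (0::complex) 1" and ?Q = "cbox (0, 0) (2 * pi, 2 * pi) :: (real \<times> real) set"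
  have cis_Arg2pi: "cis (Arg2pi z) = z" if "norm z = 1" for z
    using Arg2pi_eq[of z] that by (simp add: cis_conv_exp)
  have "\<exists>i::int. Arg2pi (cis x) = x + 2 * pi * of_int i" for x
    using cis_Arg2pi[of "cis x"] sin_cos_eq_iff[of "Arg2pi (cis x)" x]
    by (auto simp: complex_eq_iff)
  then have F: "F (torus_embed p) = f p" for p
    using torus_periodic_int[OF assms(2)] unfolding F_def torus_embed_def
    by (metis fst_conv snd_conv prod.collapse)
  have "F -` C \<inter> ?K = torus_embed ` (?Q \<inter> f -` C)" for C
  proof (intro equalityI subsetI)
    fix k assume k: "k \<in> F -` C \<inter> ?K"
    then have "k = torus_embed (Arg2pi (fst k), Arg2pi (snd k))"
      by (auto simp: torus_embed_def cis_Arg2pi)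
    moreover have "(Arg2pi (fst k), Arg2pi (snd k)) \<in> ?Q \<inter> f -` C"
      using k Arg2pi_ge_0 Arg2pi_lt_2pi by (auto simp: F_def less_imp_le)
    ultimately show "k \<in> torus_embed ` (?Q \<inter> f -` C)" by blast
  qed (auto simp: F, auto simp: torus_embed_def)
  moreover have "closed (torus_embed ` (?Q \<inter> f -` C))" if "closed C" for C
    by (intro compact_imp_closed compact_continuous_image continuous_on_torus_embed
        compact_Int_closed compact_cbox continuous_closed_vimage that
        assms(1)[unfolded continuous_on_eq_continuous_at[OF open_UNIV], rule_format] UNIV_I)
  ultimately have "continuous_on ?K F"
    by (subst continuous_on_closed_vimage) (auto intro!: closed_Times)
  then show ?thesis using F that by blast
qed

text \<open>By the Stone--Weierstrass theorem a function \<open>f\<close> without Hartley coefficients is a uniform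
  limit of trigonometric polynomials, to all of which it is orthogonal; so it is orthogonal to itself.\<close>

lemma hartley_complete:
  fixes f :: "real \<times> real \<Rightarrow> real"
  assumes cont: "continuous_on UNIV f" and per: "torus_periodic f"
    and null: "\<And>m n. hartley_coeff m n f = 0"
  shows "f p = 0"
proof -
  obtain F where F: "continuous_on (sphere 0 1 \<times> sphere 0 1) F" "\<And>p. F (torus_embed p) = f p"
    using torus_periodic_factor[OF cont per] by blast
  let ?Q = "cbox (0, 0) (2 * pi, 2 * pi) :: (real \<times> real) set"
  let ?A = "torus_integral (\<lambda>p. \<bar>f p\<bar>)"
  \<comment> \<open>\<open>\<integral>f\<^sup>2 = \<integral>f (f - P)\<close> for a trigonometric polynomial \<open>P\<close>, which can be taken \<open>e\<close>-close to \<open>f\<close>.\<close>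
  have bound: "torus_integral (\<lambda>p. (f p)\<^sup>2) \<le> e * ?A" if e: "e > 0" for e
  proof -
    obtain P where P: "real_polynomial_function P"
      "\<And>k. k \<in> sphere 0 1 \<times> sphere 0 1 \<Longrightarrow> \<bar>F k - P k\<bar> < e"
      using Stone_Weierstrass_real_polynomial_function[OF _ F(1) e] compact_Times[OF compact_sphere compact_sphere]
      by blast
    have "hartley_null (\<lambda>p. f p * P (torus_embed p))"
      using P(1) cont null by (intro hartley_null_mult_polynomial) (auto simp: hartley_null_def)
    then have fP: "continuous_on UNIV (\<lambda>p. f p * P (torus_embed p))"
      "hartley_coeff 0 0 (\<lambda>p. f p * P (torus_embed p)) = 0" by (auto simp: hartley_null_def)
    have "torus_integral (\<lambda>p. (f p)\<^sup>2) = torus_integral (\<lambda>p. (f p)\<^sup>2 - f p * P (torus_embed p))"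
      using fP by (subst torus_integral_diff) (auto simp: hartley_coeff_def intro!: continuous_intros cont)
    also have "\<dots> \<le> torus_integral (\<lambda>p. e * \<bar>f p\<bar>)"
      unfolding torus_integral_def
    proof (rule integral_le)
      fix p
      have "\<bar>F (torus_embed p) - P (torus_embed p)\<bar> \<le> e"
        by (intro less_imp_le P) (auto simp: torus_embed_def)
      then have "\<bar>f p\<bar> * \<bar>f p - P (torus_embed p)\<bar> \<le> \<bar>f p\<bar> * e"
        by (intro mult_left_mono) (auto simp: F)
      then show "(f p)\<^sup>2 - f p * P (torus_embed p) \<le> e * \<bar>f p\<bar>"
        by (simp add: abs_mult[symmetric] algebra_simps power2_eq_square)
    qed (intro continuous_torus_integrable continuous_intros cont fP)+
    finally show ?thesis by (simp add: torus_integral_cmult)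
  qed
  have "torus_integral (\<lambda>p. (f p)\<^sup>2) \<le> 0"
  proof (rule field_le_epsilon)
    fix e :: real assume "e > 0"
    have "0 \<le> ?A" unfolding torus_integral_def
      by (intro integral_nonneg continuous_torus_integrable continuous_intros cont) auto
    then have "e / (?A + 1) * ?A \<le> e" using \<open>e > 0\<close> by (auto simp: field_simps)
    moreover have "torus_integral (\<lambda>p. (f p)\<^sup>2) \<le> e / (?A + 1) * ?A"
      using \<open>0 \<le> ?A\<close> \<open>e > 0\<close> by (intro bound) auto
    ultimately show "torus_integral (\<lambda>p. (f p)\<^sup>2) \<le> 0 + e" by simp
  qed
  moreover have "0 \<le> torus_integral (\<lambda>p. (f p)\<^sup>2)" unfolding torus_integral_def
    by (intro integral_nonneg continuous_torus_integrable continuous_intros cont) auto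
  ultimately have "integral ?Q (\<lambda>p. (f p)\<^sup>2) = 0"
    by (simp add: torus_integral_def)
  moreover have "box (0, 0) (2 * pi, 2 * pi) \<noteq> ({} :: (real \<times> real) set)"
    by (auto simp: box_ne_empty Basis_prod_def)
  moreover have "continuous_on ?Q (\<lambda>p. (f p)\<^sup>2)"
    by (intro continuous_intros continuous_on_subset[OF cont]) auto
  ultimately have zero: "f q = 0" if "q \<in> ?Q" for q
    using integral_cbox_eq_0_iff[of "(0, 0)" "(2 * pi, 2 * pi)" "\<lambda>p. (f p)\<^sup>2"] that by auto
  obtain x y where p: "p = (x, y)" by (cases p)
  let ?q = "(Arg2pi (cis x), Arg2pi (cis y))"
  have "?q \<in> ?Q" using Arg2pi_ge_0 Arg2pi_lt_2pi by (auto simp: less_imp_le)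
  then have "f ?q = 0" by (rule zero)
  moreover have "torus_embed ?q = torus_embed p"
    using Arg2pi_eq[of "cis x"] Arg2pi_eq[of "cis y"] by (simp add: p torus_embed_def cis_conv_exp)
  ultimately show ?thesis by (metis F(2))
qed


section \<open>An orthonormal frame along the map\<close>

text \<open>The length of \<open>d\<phi>(\<partial>\<^sub>\<gamma>)\<close>.\<close>

definition speed :: "nat \<Rightarrow> real" where
  "speed k = real k / sqrt 2"

definition frame_X :: "nat \<Rightarrow> real \<times> real \<Rightarrow> real ^ 3" where
  "frame_X k p = vector [- sin (real k * fst p), cos (real k * fst p), 0]"

definition frame_Y :: "nat \<Rightarrow> real \<times> real \<Rightarrow> real ^ 3" where
  "frame_Y k p = vector [cos (real k * fst p) / sqrt 2, sin (real k * fst p) / sqrt 2, - 1 / sqrt 2]"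

lemma phi_eq:
  "phi k p = vector [cos (real k * fst p) / sqrt 2, sin (real k * fst p) / sqrt 2, 1 / sqrt 2]"
  by (simp add: phi_def alpha_star_def sin_45 cos_45 case_prod_unfold vec_eq_iff forall_3 field_simps)

lemma vector_3_eq: "(vector [a, b, c] :: real^3) = a *\<^sub>R axis 1 1 + b *\<^sub>R axis 2 1 + c *\<^sub>R axis 3 1"
  by (auto simp: vec_eq_iff forall_3 axis_def)

lemma frame_inner [simp]:
  "frame_X k p \<bullet> frame_X k p = 1" "frame_Y k p \<bullet> frame_Y k p = 1" "phi k p \<bullet> phi k p = 1"
  "frame_X k p \<bullet> frame_Y k p = 0" "frame_Y k p \<bullet> frame_X k p = 0"
  "frame_X k p \<bullet> phi k p = 0" "phi k p \<bullet> frame_X k p = 0"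
  "frame_Y k p \<bullet> phi k p = 0" "phi k p \<bullet> frame_Y k p = 0"
proof -
  have *: "c * c / 2 + s * s / 2 = 1 / 2" if "c * c + s * s = 1" for c s :: real
    using that by (simp add: add_divide_distrib[symmetric])
  show "frame_X k p \<bullet> frame_X k p = 1" "frame_Y k p \<bullet> frame_Y k p = 1" "phi k p \<bullet> phi k p = 1"
    "frame_X k p \<bullet> frame_Y k p = 0" "frame_Y k p \<bullet> frame_X k p = 0"
    "frame_X k p \<bullet> phi k p = 0" "phi k p \<bullet> frame_X k p = 0"
    "frame_Y k p \<bullet> phi k p = 0" "phi k p \<bullet> frame_Y k p = 0"
    by (simp_all add: phi_eq frame_X_def frame_Y_def inner_vec_def sum_3 algebra_simps
        *[OF sin_cos_squared_add3] sin_cos_squared_add3)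
qed

text \<open>\<open>X, Y, \<phi>\<close> form an orthonormal basis of \<open>\<real>\<^sup>3\<close>; this is checked by coordinates, eliminating
  \<open>sin\<^sup>2\<close> and \<open>1 / \<surd>2\<close>.\<close>

lemma frame_expansion:
  fixes v :: "real ^ 3"
  shows "v = (v \<bullet> frame_X k p) *\<^sub>R frame_X k p + (v \<bullet> frame_Y k p) *\<^sub>R frame_Y k p + (v \<bullet> phi k p) *\<^sub>R phi k p"
proof -
  define c s where "c = cos (real k * fst p)" and "s = sin (real k * fst p)"
  have cs: "c * c + s * s = 1" by (simp add: c_def s_def sin_cos_squared_add3)
  have ss: "s * s = 1 - c * c" using cs by simp
  define t where "t = 1 / sqrt 2"
  have t: "t * t = 1 / 2" "x / sqrt 2 = x * t" for x by (simp_all add: t_def)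
  have "t * (t * y) = y / 2" for y using t(1) by (simp add: mult.assoc[symmetric])
  moreover have "s * (s * y) = y - c * (c * y)" for y
    using ss by (simp add: mult.assoc[symmetric] left_diff_distrib)
  ultimately have rules: "t * (t * y) = y / 2" "s * (s * y) = y - c * (c * y)" for y by simp_all
  show ?thesis
    unfolding vec_eq_iff forall_3 phi_eq frame_X_def frame_Y_def inner_vec_def sum_3
      c_def[symmetric] s_def[symmetric]
    by (simp add: t(2)) (simp add: algebra_simps rules ss t)
qed

lemma frame_has_derivative:
  "(phi k has_derivative (\<lambda>e. (speed k * fst e) *\<^sub>R frame_X k p)) (at p)"
  "(frame_X k has_derivative (\<lambda>e. - (speed k * fst e) *\<^sub>R (frame_Y k p + phi k p))) (at p)"
  "(frame_Y k has_derivative (\<lambda>e. (speed k * fst e) *\<^sub>R frame_X k p)) (at p)"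
proof -
  have vec: "((\<lambda>q. vector [f q, g q, h q] :: real^3) has_derivative (\<lambda>v. vector [f' v, g' v, h' v])) (at p)"
    if "(f has_derivative f') (at p)" "(g has_derivative g') (at p)" "(h has_derivative h') (at p)"
    for f g h :: "real \<times> real \<Rightarrow> real" and f' g' h'
    unfolding vector_3_eq using that by (auto intro!: derivative_eq_intros)
  have cs: "((\<lambda>q. cos (real k * fst q)) has_derivative (\<lambda>v. - (real k * fst v * sin (real k * fst p)))) (at p)"
    "((\<lambda>q. sin (real k * fst q)) has_derivative (\<lambda>v. real k * fst v * cos (real k * fst p))) (at p)"
    by (auto intro!: derivative_eq_intros simp: algebra_simps)
  have cs': "((\<lambda>q. cos (real k * fst q) / sqrt 2) has_derivative (\<lambda>v. - (real k * fst v * sin (real k * fst p)) / sqrt 2)) (at p)"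
    "((\<lambda>q. sin (real k * fst q) / sqrt 2) has_derivative (\<lambda>v. real k * fst v * cos (real k * fst p) / sqrt 2)) (at p)"
    by (auto intro!: derivative_eq_intros simp: field_simps)
  note d = cs has_derivative_minus[OF cs(2)] cs' has_derivative_const
  show "(phi k has_derivative (\<lambda>e. (speed k * fst e) *\<^sub>R frame_X k p)) (at p)"
    unfolding phi_eq[abs_def]
    by (rule has_derivative_eq_rhs[OF vec[OF d(4,5,6)]])
       (simp add: fun_eq_iff vec_eq_iff forall_3 frame_X_def speed_def)
  show "(frame_X k has_derivative (\<lambda>e. - (speed k * fst e) *\<^sub>R (frame_Y k p + phi k p))) (at p)"
    unfolding frame_X_def[abs_def]
    by (rule has_derivative_eq_rhs[OF vec[OF d(3,1,6)]])
       (simp add: fun_eq_iff vec_eq_iff forall_3 frame_Y_def phi_eq speed_def field_simps)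
  show "(frame_Y k has_derivative (\<lambda>e. (speed k * fst e) *\<^sub>R frame_X k p)) (at p)"
    unfolding frame_Y_def[abs_def]
    by (rule has_derivative_eq_rhs[OF vec[OF d(4,5,6)]])
       (simp add: fun_eq_iff vec_eq_iff forall_3 frame_X_def speed_def)
qed

lemma smooth_frame: "smooth (phi k)" "smooth (frame_X k)" "smooth (frame_Y k)"
proof -
  have "bounded_linear (\<lambda>p::real \<times> real. real k * fst p)" by (intro bounded_linear_intros)
  from smooth_cos_sin_linear[OF this]
  have trig: "smooth (\<lambda>p::real \<times> real. A * cos (real k * fst p) + B * sin (real k * fst p))" for A B .
  show "smooth (phi k)"
    unfolding phi_eq[abs_def]
    using trig[of "1 / sqrt 2" 0] trig[of 0 "1 / sqrt 2"] by (intro smooth_vector_3 smooth_const) auto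
  show "smooth (frame_X k)"
    unfolding frame_X_def[abs_def]
    using trig[of 0 "- 1"] trig[of 1 0] by (intro smooth_vector_3 smooth_const) auto
  show "smooth (frame_Y k)"
    unfolding frame_Y_def[abs_def]
    using trig[of "1 / sqrt 2" 0] trig[of 0 "1 / sqrt 2"] by (intro smooth_vector_3 smooth_const) auto
qed

lemma torus_periodic_frame: "torus_periodic (phi k)" "torus_periodic (frame_X k)" "torus_periodic (frame_Y k)"
proof -
  have "cos (real k * (x + 2 * pi)) = cos (real k * x)" "sin (real k * (x + 2 * pi)) = sin (real k * x)" for x
    using sin_cos_eq_iff[of "real k * (x + 2 * pi)" "real k * x"]
    by (auto intro!: exI[of _ "int k"] simp: algebra_simps)
  then show "torus_periodic (phi k)" "torus_periodic (frame_X k)" "torus_periodic (frame_Y k)"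
    by (simp_all add: torus_periodic_def phi_eq frame_X_def frame_Y_def)
qed

definition frame :: "nat \<Rightarrow> (real \<times> real \<Rightarrow> real) \<Rightarrow> (real \<times> real \<Rightarrow> real) \<Rightarrow> real \<times> real \<Rightarrow> real ^ 3" where
  "frame k a b = (\<lambda>p. a p *\<^sub>R frame_X k p + b p *\<^sub>R frame_Y k p)"

lemma frame_components [simp]:
  "frame k a b p \<bullet> frame_X k p = a p" "frame k a b p \<bullet> frame_Y k p = b p" "frame k a b p \<bullet> phi k p = 0"
  by (simp_all add: frame_def inner_add_left)

lemma inner_frame: "frame k a b p \<bullet> frame k a' b' p = a p * a' p + b p * b' p"
  by (simp add: frame_def inner_add_left inner_add_right)

lemma frame_vector_space:
  "frame k a b p + frame k a' b' p = frame k (\<lambda>p. a p + a' p) (\<lambda>p. b p + b' p) p"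
  "frame k a b p - frame k a' b' p = frame k (\<lambda>p. a p - a' p) (\<lambda>p. b p - b' p) p"
  "c *\<^sub>R frame k a b p = frame k (\<lambda>p. c * a p) (\<lambda>p. c * b p) p"
  "- frame k a b p = frame k (\<lambda>p. - a p) (\<lambda>p. - b p) p"
  by (simp_all add: frame_def algebra_simps)

lemma frame_in_sections:
  assumes "smooth a" "torus_periodic a" "smooth b" "torus_periodic b"
  shows "frame k a b \<in> sections (phi k)"
proof -
  have "torus_periodic (frame k a b)"
    using assms torus_periodic_frame[of k] by (simp add: frame_def torus_periodic_def)
  moreover have "smooth (frame k a b)"
    unfolding frame_def by (intro smooth_add smooth_scaleR smooth_frame assms)
  ultimately show ?thesis by (simp add: sections_def)
qed

lemma sections_frameE:
  assumes "V \<in> sections (phi k)"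
  obtains a b where "V = frame k a b" "smooth a" "torus_periodic a" "smooth b" "torus_periodic b"
proof
  have V: "smooth V" "torus_periodic V" "\<And>p. V p \<bullet> phi k p = 0"
    using assms by (auto simp: sections_def)
  show "V = frame k (\<lambda>p. V p \<bullet> frame_X k p) (\<lambda>p. V p \<bullet> frame_Y k p)"
  proof
    fix p
    show "V p = frame k (\<lambda>p. V p \<bullet> frame_X k p) (\<lambda>p. V p \<bullet> frame_Y k p) p"
      using frame_expansion[of "V p" k p] V(3)[of p] by (simp add: frame_def)
  qed
  show "smooth (\<lambda>p. V p \<bullet> frame_X k p)" "smooth (\<lambda>p. V p \<bullet> frame_Y k p)"
    by (intro smooth_inner V smooth_frame)+
  show "torus_periodic (\<lambda>p. V p \<bullet> frame_X k p)" "torus_periodic (\<lambda>p. V p \<bullet> frame_Y k p)"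
    using V(2) torus_periodic_frame[of k] by (simp_all add: torus_periodic_def)
qed

lemma frame_eq_iff: "frame k a b p = frame k a' b' p \<longleftrightarrow> a p = a' p \<and> b p = b' p"
  by (metis frame_components(1,2) frame_def)


section \<open>The second variation in the frame\<close>

lemma sum_Basis_plane: "(\<Sum>e\<in>Basis. g (e :: real \<times> real)) = g (1, 0) + g (0, 1)"
  by (simp add: Basis_prod_def add.commute)

text \<open>The connection acts on the components by the flat derivative and an infinitesimal rotation with
  constant speed, present only in the direction of \<open>\<gamma>\<close>.\<close>

lemma cov_deriv_frame:
  assumes "smooth a" "smooth b"
  shows "cov_deriv (phi k) e (frame k a b) =
    frame k (\<lambda>p. pderiv_dir e a p + speed k * fst e * b p) (\<lambda>p. pderiv_dir e b p - speed k * fst e * a p)"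
proof
  fix p
  have "pderiv_dir e (frame k a b) p =
      (a p *\<^sub>R (- (speed k * fst e) *\<^sub>R (frame_Y k p + phi k p)) + pderiv_dir e a p *\<^sub>R frame_X k p)
      + (b p *\<^sub>R ((speed k * fst e) *\<^sub>R frame_X k p) + pderiv_dir e b p *\<^sub>R frame_Y k p)"
    unfolding frame_def
    by (rule trans[OF pderiv_dir_eqI[OF has_derivative_add[OF
            has_derivative_scaleR[OF smooth_has_pderiv[OF assms(1)] frame_has_derivative(2)]
            has_derivative_scaleR[OF smooth_has_pderiv[OF assms(2)] frame_has_derivative(3)]]]])
       (rule refl)
  then have "pderiv_dir e (frame k a b) p =
      (pderiv_dir e a p + speed k * fst e * b p) *\<^sub>R frame_X k p
      + (pderiv_dir e b p - speed k * fst e * a p) *\<^sub>R frame_Y k p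
      - (speed k * fst e * a p) *\<^sub>R phi k p"
    by (simp add: algebra_simps)
  then show "cov_deriv (phi k) e (frame k a b) p = frame k (\<lambda>p. pderiv_dir e a p + speed k * fst e * b p)
      (\<lambda>p. pderiv_dir e b p - speed k * fst e * a p) p"
    unfolding cov_deriv_def by (simp add: frame_def inner_add_left inner_diff_left)
qed

text \<open>The Laplacian with nonnegative spectrum, as in \<^const>\<open>rough_laplacian\<close>.\<close>

definition lap :: "(real \<times> real \<Rightarrow> real) \<Rightarrow> real \<times> real \<Rightarrow> real" where
  "lap f p = - (pderiv_dir (1, 0) (pderiv_dir (1, 0) f) p + pderiv_dir (0, 1) (pderiv_dir (0, 1) f) p)"

lemma smooth_lap: "smooth f \<Longrightarrow> smooth (lap f)"
  unfolding lap_def[abs_def] by (intro smooth_uminus smooth_add smooth_pderiv_dir)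

lemma torus_periodic_lap:
  assumes "smooth f" "torus_periodic f"
  shows "torus_periodic (lap f)"
proof -
  have "torus_periodic (pderiv_dir e (pderiv_dir e f))" for e
    by (intro torus_periodic_pderiv_dir smooth_pderiv_dir assms)
  then show ?thesis by (simp add: lap_def torus_periodic_def)
qed

lemmas pderiv_dir_simps = pderiv_dir_add pderiv_dir_diff pderiv_dir_cmult pderiv_dir_const
lemmas smooth_intros = smooth_const smooth_mult smooth_add smooth_diff smooth_pderiv_dir smooth_lap

lemma lap_linear:
  assumes "smooth f" "smooth g"
  shows "lap (\<lambda>q. f q + g q) p = lap f p + lap g p" "lap (\<lambda>q. f q - g q) p = lap f p - lap g p"
    "lap (\<lambda>q. c * f q) p = c * lap f p"
  using assms by (simp_all add: lap_def pderiv_dir_simps smooth_intros algebra_simps)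

lemma rough_laplacian_frame:
  assumes "smooth a" "smooth b"
  shows "rough_laplacian (phi k) (frame k a b) =
    frame k (\<lambda>p. lap a p - 2 * speed k * pderiv_dir (1, 0) b p + (speed k)\<^sup>2 * a p)
      (\<lambda>p. lap b p + 2 * speed k * pderiv_dir (1, 0) a p + (speed k)\<^sup>2 * b p)"
  unfolding rough_laplacian_def[abs_def] sum_Basis_plane
  using assms
  by (simp add: cov_deriv_frame pderiv_dir_simps smooth_intros fun_eq_iff)
     (simp add: frame_def lap_def algebra_simps power2_eq_square)

lemma pderiv_dir_phi: "pderiv_dir e (phi k) = frame k (\<lambda>p. speed k * fst e) (\<lambda>p. 0)"
  by (auto simp: frame_def pderiv_dir_eqI[OF frame_has_derivative(1)])

lemma tension_phi: "tension (phi k) = frame k (\<lambda>p. 0) (\<lambda>p. - (speed k)\<^sup>2)"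
  unfolding tension_def[abs_def] sum_Basis_plane
  by (simp add: pderiv_dir_phi cov_deriv_frame smooth_const pderiv_dir_const)
     (simp add: frame_def power2_eq_square)

lemma normsq_d_phi: "normsq_d (phi k) p = (speed k)\<^sup>2"
  unfolding normsq_d_def sum_Basis_plane power2_norm_eq_inner
  by (simp add: pderiv_dir_phi inner_frame power2_eq_square)

lemma trace_op_frame: "trace_op (phi k) (frame k a b) = frame k (\<lambda>p. (speed k)\<^sup>2 * a p) (\<lambda>p. 0)"
  unfolding trace_op_def[abs_def] sum_Basis_plane
  by (simp add: pderiv_dir_phi inner_frame) (simp add: frame_def power2_eq_square algebra_simps)

lemma inner_d_frame:
  assumes "smooth a" "smooth b"
  shows "inner_d (phi k) (frame k a b) p = speed k * (pderiv_dir (1, 0) a p + speed k * b p)"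
  unfolding inner_d_def sum_Basis_plane
  by (simp add: cov_deriv_frame assms pderiv_dir_phi inner_frame)

text \<open>With \<open>c = speed k\<close>, the contributions of \<open>c\<^sup>3 \<partial>\<^sub>\<gamma> a\<close>, \<open>c\<^sup>3 \<partial>\<^sub>\<gamma> b\<close>, \<open>c\<^sup>4 a\<close> and
  \<open>c\<^sup>2 lap b\<close> cancel. The operators \<open>lap\<close> and \<open>\<partial>\<^sub>\<gamma>\<close> are left in the order in which they arise: only
  Hartley coefficients of the result are taken later, and these do not depend on the order.\<close>

lemma second_variation_frame:
  assumes "smooth a" "smooth b"
  shows "second_variation (phi k) (frame k a b) =
    frame k
      (\<lambda>p. lap (lap a) p + 2 * (speed k)\<^sup>2 * lap a p - 4 * (speed k)\<^sup>2 * pderiv_dir (1, 0) (pderiv_dir (1, 0) a) p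
        - 2 * speed k * (lap (pderiv_dir (1, 0) b) p + pderiv_dir (1, 0) (lap b) p))
      (\<lambda>p. lap (lap b) p - 4 * (speed k)\<^sup>2 * pderiv_dir (1, 0) (pderiv_dir (1, 0) b) p - 4 * (speed k)^4 * b p
        + 2 * speed k * (lap (pderiv_dir (1, 0) a) p + pderiv_dir (1, 0) (lap a) p))"
proof
  fix p
  (* The argument of the second rough Laplacian in the second variation operator. *)
  have T: "(\<lambda>q. frame k (\<lambda>p. (speed k)\<^sup>2 * a p) (\<lambda>p. 0) q - (speed k)\<^sup>2 *\<^sub>R frame k a b q) =
      frame k (\<lambda>p. 0) (\<lambda>p. - (speed k)\<^sup>2 * b p)"
    by (auto simp: frame_def algebra_simps)
  have "rough_laplacian (phi k) (frame k (\<lambda>p. 0) (\<lambda>p. - (speed k)\<^sup>2 * b p)) =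
      frame k (\<lambda>p. 2 * speed k ^ 3 * pderiv_dir (1, 0) b p) (\<lambda>p. - (speed k)\<^sup>2 * lap b p - speed k ^ 4 * b p)"
    unfolding rough_laplacian_frame[OF smooth_const smooth_mult[OF smooth_const assms(2)]]
      pderiv_dir_cmult[OF assms(2)] lap_linear(3)[OF assms(2) assms(2)] pderiv_dir_const
    by (simp add: lap_def pderiv_dir_const power2_eq_square power3_eq_cube power4_eq_xxxx mult.assoc)
  note unfold = second_variation_def sum_Basis_plane trace_op_frame normsq_d_phi T this tension_phi
  show "second_variation (phi k) (frame k a b) p = frame k
      (\<lambda>p. lap (lap a) p + 2 * (speed k)\<^sup>2 * lap a p - 4 * (speed k)\<^sup>2 * pderiv_dir (1, 0) (pderiv_dir (1, 0) a) p
        - 2 * speed k * (lap (pderiv_dir (1, 0) b) p + pderiv_dir (1, 0) (lap b) p))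
      (\<lambda>p. lap (lap b) p - 4 * (speed k)\<^sup>2 * pderiv_dir (1, 0) (pderiv_dir (1, 0) b) p - 4 * (speed k)^4 * b p
        + 2 * speed k * (lap (pderiv_dir (1, 0) a) p + pderiv_dir (1, 0) (lap a) p)) p"
    unfolding unfold
    using assms
    by (simp add: rough_laplacian_frame cov_deriv_frame inner_d_frame trace_op_frame pderiv_dir_phi
        pderiv_dir_simps lap_linear smooth_intros inner_frame power2_norm_eq_inner
        frame_vector_space frame_eq_iff)
       (simp add: algebra_simps power2_eq_square power3_eq_cube power4_eq_xxxx)
qed


section \<open>Biharmonicity\<close>

text \<open>The componentwise Laplacian of the ambient Euclidean space, with the sign that makes the tension
  field its tangential part.\<close>

definition flat_laplacian :: "(real \<times> real \<Rightarrow> 'b::euclidean_space) \<Rightarrow> real \<times> real \<Rightarrow> 'b" where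
  "flat_laplacian f p = (\<Sum>e\<in>Basis. pderiv_dir e (pderiv_dir e f) p)"

lemma tension_eq: "tension \<phi> p = flat_laplacian \<phi> p - (flat_laplacian \<phi> p \<bullet> \<phi> p) *\<^sub>R \<phi> p"
  by (simp add: tension_def cov_deriv_def flat_laplacian_def sum_subtractf scaleR_sum_left inner_sum_left)

lemma smooth_flat_laplacian: "smooth f \<Longrightarrow> smooth (flat_laplacian f)"
  unfolding flat_laplacian_def[abs_def] by (intro smooth_sum smooth_pderiv_dir)

lemma torus_integral_flat_laplacian:
  fixes f g :: "real \<times> real \<Rightarrow> 'a::euclidean_space"
  assumes "smooth f" "smooth g" "torus_periodic f" "torus_periodic g"
  shows "torus_integral (\<lambda>p. f p \<bullet> flat_laplacian g p) = torus_integral (\<lambda>p. flat_laplacian f p \<bullet> g p)"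
proof -
  have "torus_integral (\<lambda>p. f p \<bullet> pderiv_dir e (pderiv_dir e g) p) =
      torus_integral (\<lambda>p. pderiv_dir e (pderiv_dir e f) p \<bullet> g p)" if "e \<in> Basis" for e
    using torus_integral_by_parts[OF assms(1) smooth_pderiv_dir[OF assms(2)] assms(3)
        torus_periodic_pderiv_dir[OF assms(2,4)] that]
      torus_integral_by_parts[OF smooth_pderiv_dir[OF assms(1)] assms(2)
        torus_periodic_pderiv_dir[OF assms(1,3)] assms(4) that]
    by simp
  moreover have "continuous_on UNIV (\<lambda>p. f p \<bullet> pderiv_dir e (pderiv_dir e g) p)"
    "continuous_on UNIV (\<lambda>p. pderiv_dir e (pderiv_dir e f) p \<bullet> g p)" for e
    by (intro smooth_continuous_on smooth_inner smooth_pderiv_dir assms)+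
  ultimately show ?thesis
    by (simp add: flat_laplacian_def sum_Basis_plane inner_add_left inner_add_right
        torus_integral_add in_Basis_plane)
qed

lemma pderiv_dir_slice:
  assumes "smooth G"
  shows "pderiv_dir e (\<lambda>p. G (t, p)) p = frechet_derivative G (at (t, p)) (0, e)"
proof (rule pderiv_dir_eqI)
  have "((\<lambda>p. (t, p)) has_derivative (\<lambda>h. (0, h))) (at p)"
    by (auto intro!: derivative_eq_intros)
  from has_derivative_compose[OF this smooth_has_derivative[OF assms]]
  show "((\<lambda>p. G (t, p)) has_derivative (\<lambda>e. frechet_derivative G (at (t, p)) (0, e))) (at p)" .
qed

lemma frechet_derivative_snd:
  assumes "smooth f"
  shows "frechet_derivative (\<lambda>z. f (snd z)) (at z) (1, 0) = 0"
proof -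
  have "(snd has_derivative snd) (at z)"
    by (auto intro!: derivative_eq_intros)
  from has_derivative_compose[OF this smooth_has_derivative[OF assms]]
  have "frechet_derivative (\<lambda>z. f (snd z)) (at z) = (\<lambda>h. frechet_derivative f (at (snd z)) (snd h))"
    by (metis frechet_derivative_at)
  then show ?thesis
    using linear_0[OF has_derivative_linear[OF smooth_has_derivative[OF assms]]] by simp
qed

lemma smooth_snd: "smooth f \<Longrightarrow> smooth (\<lambda>z. f (snd z))"
  using smooth_affine_comp[OF bounded_linear_snd, of f 0] by simp

lemma flat_laplacian_frame:
  "flat_laplacian (phi k) p = - (speed k)\<^sup>2 *\<^sub>R (frame_Y k p + phi k p)"
  "flat_laplacian (\<lambda>p. c *\<^sub>R frame_Y k p) p = - (c * (speed k)\<^sup>2) *\<^sub>R (frame_Y k p + phi k p)"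
proof -
  have d: "pderiv_dir e (phi k) = (\<lambda>p. (speed k * fst e) *\<^sub>R frame_X k p)"
    "pderiv_dir e (frame_Y k) = (\<lambda>p. (speed k * fst e) *\<^sub>R frame_X k p)"
    "pderiv_dir e (frame_X k) = (\<lambda>p. - (speed k * fst e) *\<^sub>R (frame_Y k p + phi k p))" for e
    by (auto simp: pderiv_dir_eqI[OF frame_has_derivative(1)] pderiv_dir_eqI[OF frame_has_derivative(2)]
        pderiv_dir_eqI[OF frame_has_derivative(3)])
  note s = pderiv_dir_scaleR[OF smooth_frame(2)] pderiv_dir_scaleR[OF smooth_frame(3)]
  show "flat_laplacian (phi k) p = - (speed k)\<^sup>2 *\<^sub>R (frame_Y k p + phi k p)"
    "flat_laplacian (\<lambda>p. c *\<^sub>R frame_Y k p) p = - (c * (speed k)\<^sup>2) *\<^sub>R (frame_Y k p + phi k p)"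
    unfolding flat_laplacian_def sum_Basis_plane
    by (simp_all add: d s power2_eq_square mult.assoc pderiv_dir_const)
qed

lemma tension_phi_eq: "tension (phi k) = (\<lambda>p. - (speed k)\<^sup>2 *\<^sub>R frame_Y k p)"
  by (simp add: tension_phi frame_def)

lemma torus_sphere_map_phi: "torus_sphere_map (phi k)"
  by (simp add: torus_sphere_map_def smooth_frame torus_periodic_frame norm_eq_1)

text \<open>Replacing \<open>1/2 \<integral>\<bar>\<tau>\<^sub>t\<bar>\<^sup>2\<close> by \<open>\<integral>\<langle>\<tau>\<^sub>0, \<tau>\<^sub>t\<rangle>\<close> before differentiating makes it possible to integrate
  by parts at fixed \<open>t\<close>, so that derivatives in \<open>t\<close> never have to be exchanged with derivatives on the
  torus.\<close>

lemma biharmonic_phi: "biharmonic (phi k)"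
  unfolding biharmonic_def
proof (intro conjI allI impI torus_sphere_map_phi)
  fix \<Phi> :: "real \<Rightarrow> real \<times> real \<Rightarrow> real ^ 3"
  assume "smooth_variation (phi k) \<Phi>"
  then have s\<Psi>: "smooth (\<lambda>(t, p). \<Phi> t p)" and \<Phi>: "\<And>t. torus_sphere_map (\<Phi> t)" "\<Phi> 0 = phi k"
    by (auto simp: smooth_variation_def)
  have s\<Phi>: "smooth (\<Phi> t)" "torus_periodic (\<Phi> t)" "\<Phi> t p \<bullet> \<Phi> t p = 1" for t p
    using \<Phi>(1)[of t] by (simp_all add: torus_sphere_map_def norm_eq_1 del: split_paired_All)
  define \<Psi> where "\<Psi> z = \<Phi> (fst z) (snd z)" for z
  have \<Psi>: "smooth \<Psi>" "\<And>t p. \<Psi> (t, p) = \<Phi> t p"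
    using s\<Psi> by (simp_all add: \<Psi>_def[abs_def] case_prod_unfold)
  define L where "L z = (\<Sum>e\<in>Basis. frechet_derivative (\<lambda>z. frechet_derivative \<Psi> (at z) (0, e)) (at z) (0, e))" for z
  have sL: "smooth L"
    unfolding L_def[abs_def] by (intro smooth_sum smooth_frechet_derivative \<Psi>)
  have L: "L (t, p) = flat_laplacian (\<Phi> t) p" for t p
  proof -
    have "pderiv_dir e (\<Phi> t) = (\<lambda>p. frechet_derivative \<Psi> (at (t, p)) (0, e))" for e
      using pderiv_dir_slice[OF \<Psi>(1), of e t] by (auto simp: \<Psi>(2))
    then show ?thesis
      by (simp add: L_def flat_laplacian_def pderiv_dir_slice[OF smooth_frechet_derivative[OF \<Psi>(1)]])
  qed
  define T where "T z = L z - (L z \<bullet> \<Psi> z) *\<^sub>R \<Psi> z" for z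
  have sT: "smooth T"
    unfolding T_def[abs_def] by (intro smooth_diff smooth_scaleR smooth_inner sL \<Psi>)
  have T: "T (t, p) = tension (\<Phi> t) p" for t p
    by (simp add: T_def tension_eq L \<Psi>(2))
  define \<tau> where "\<tau> = tension (phi k)"
  have \<tau>: "\<tau> = (\<lambda>p. - (speed k)\<^sup>2 *\<^sub>R frame_Y k p)" by (simp add: \<tau>_def tension_phi_eq)
  have s\<tau>: "smooth \<tau>" "torus_periodic \<tau>"
    using torus_periodic_frame(3)[of k] unfolding \<tau>
    by (auto intro!: smooth_uminus smooth_scaleR smooth_const smooth_frame simp: torus_periodic_def)
  define U where "U p = frechet_derivative \<Psi> (at (0, p)) (1, 0)" for p
  (* The variation field is tangent to the sphere: differentiate the constant squared length. *)
  have U: "phi k p \<bullet> U p = 0" for p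
  proof -
    have "(\<lambda>z. \<Psi> z \<bullet> \<Psi> z) = (\<lambda>z. 1)" by (auto simp: \<Psi>_def s\<Phi>)
    then have "0 = frechet_derivative (\<lambda>z. \<Psi> z \<bullet> \<Psi> z) (at (0, p)) (1, 0)"
      by simp
    then show ?thesis
      by (simp add: frechet_derivative_bilinear[OF bounded_bilinear_inner \<Psi>(1) \<Psi>(1)] U_def
          \<Psi>(2) \<Phi>(2) inner_commute)
  qed
  let ?I = "torus_integral (\<lambda>p. \<tau> p \<bullet> frechet_derivative T (at (0, p)) (1, 0))"
  have "((\<lambda>t. torus_integral (\<lambda>p. T (t, p) \<bullet> T (t, p))) has_real_derivative 2 * ?I) (at 0)"
    using torus_integral_has_derivative[OF smooth_inner[OF sT sT], of 0]
    by (simp add: frechet_derivative_bilinear[OF bounded_bilinear_inner sT sT] T \<Phi>(2) \<tau>_def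
        inner_commute mult_2[symmetric] torus_integral_cmult)
  then have "((\<lambda>t. 1 / 2 * torus_integral (\<lambda>p. T (t, p) \<bullet> T (t, p))) has_real_derivative 1 / 2 * (2 * ?I)) (at 0)"
    by (rule DERIV_cmult)
  then have E: "((\<lambda>t. bienergy (\<Phi> t)) has_real_derivative ?I) (at 0)"
    by (simp add: bienergy_def torus_integral_def power2_norm_eq_inner T)
  have H: "((\<lambda>t. torus_integral (\<lambda>p. \<tau> p \<bullet> T (t, p))) has_real_derivative ?I) (at 0)"
    using torus_integral_has_derivative[OF smooth_inner[OF smooth_snd[OF s\<tau>(1)] sT], of 0]
    by (simp add: frechet_derivative_bilinear[OF bounded_bilinear_inner smooth_snd[OF s\<tau>(1)] sT]
        frechet_derivative_snd[OF s\<tau>(1)])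
  (* The integrand after moving the Laplacian. Its second summand is not integrated by parts: the
     factor that pairs tau with the map vanishes at t = 0, so only that factor gets differentiated. *)
  define K where "K z = flat_laplacian \<tau> (snd z) \<bullet> \<Psi> z - (L z \<bullet> \<Psi> z) * (\<tau> (snd z) \<bullet> \<Psi> z)" for z
  note sK = smooth_inner[OF smooth_snd[OF smooth_flat_laplacian[OF s\<tau>(1)]] \<Psi>(1)]
    smooth_inner[OF sL \<Psi>(1)] smooth_inner[OF smooth_snd[OF s\<tau>(1)] \<Psi>(1)]
  have HK: "torus_integral (\<lambda>p. \<tau> p \<bullet> T (t, p)) = torus_integral (\<lambda>p. K (t, p))" for t
  proof -
    have c: "continuous_on UNIV (\<lambda>p. \<tau> p \<bullet> flat_laplacian (\<Phi> t) p)"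
      "continuous_on UNIV (\<lambda>p. flat_laplacian \<tau> p \<bullet> \<Phi> t p)"
      "continuous_on UNIV (\<lambda>p. (flat_laplacian (\<Phi> t) p \<bullet> \<Phi> t p) * (\<tau> p \<bullet> \<Phi> t p))"
      by (intro smooth_continuous_on smooth_mult smooth_inner smooth_flat_laplacian s\<tau> s\<Phi>)+
    show ?thesis
      by (simp add: T_def K_def L \<Psi>(2) inner_diff_right torus_integral_diff c
          torus_integral_flat_laplacian[OF s\<tau>(1) s\<Phi>(1) s\<tau>(2) s\<Phi>(2)])
  qed
  have "frechet_derivative K (at (0, p)) (1, 0) = 0" for p
  proof -
    have "\<tau> p \<bullet> phi k p = 0" by (simp add: \<tau>)
    then have "frechet_derivative K (at (0, p)) (1, 0) =
        flat_laplacian \<tau> p \<bullet> U p - (flat_laplacian (phi k) p \<bullet> phi k p) * (\<tau> p \<bullet> U p)"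
      unfolding K_def[abs_def]
      by (simp add: frechet_derivative_diff[OF sK(1) smooth_mult[OF sK(2,3)]]
          frechet_derivative_bilinear[OF bounded_bilinear_inner smooth_snd[OF smooth_flat_laplacian[OF s\<tau>(1)]] \<Psi>(1)]
          frechet_derivative_bilinear[OF bounded_bilinear_mult sK(2,3)]
          frechet_derivative_bilinear[OF bounded_bilinear_inner smooth_snd[OF s\<tau>(1)] \<Psi>(1)]
          frechet_derivative_snd[OF s\<tau>(1)] frechet_derivative_snd[OF smooth_flat_laplacian[OF s\<tau>(1)]]
          L \<Psi>(2) \<Phi>(2) U_def)
    also have "\<dots> = 0"
      using U[of p] unfolding \<tau> flat_laplacian_frame by (simp add: inner_add_left algebra_simps)
    finally show ?thesis .
  qed
  moreover have "smooth K"
    unfolding K_def[abs_def] by (intro smooth_diff smooth_mult sK)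
  ultimately have "((\<lambda>t. torus_integral (\<lambda>p. K (t, p))) has_real_derivative 0) (at 0)"
    using torus_integral_has_derivative[of K 0] by (simp add: torus_integral_def)
  then have "?I = 0" using H DERIV_unique unfolding HK by blast
  then show "((\<lambda>t. bienergy (\<Phi> t)) has_real_derivative 0) (at 0)" using E by simp
qed

lemma proper_biharmonic_phi:
  assumes "1 \<le> k"
  shows "proper_biharmonic (phi k)"
proof -
  have "tension (phi k) p \<bullet> frame_Y k p = - (speed k)\<^sup>2" for p by (simp add: tension_phi)
  moreover have "speed k \<noteq> 0" using assms by (simp add: speed_def)
  ultimately have "tension (phi k) 0 \<noteq> 0" by (metis inner_zero_left neg_equal_0_iff_equal power_not_zero)
  then show ?thesis using biharmonic_phi unfolding proper_biharmonic_def by blast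
qed


section \<open>The symbol of the second variation\<close>

text \<open>The entries of the symmetric matrix \<open>(A q; q B)\<close> by which \<open>I\<^sub>2\<close> acts on the coefficients at the
  frequency \<open>(x, y)\<close>.\<close>

definition symbol_A :: "nat \<Rightarrow> real \<Rightarrow> real \<Rightarrow> real" where
  "symbol_A k x y = (x\<^sup>2 + y\<^sup>2)\<^sup>2 + (real k)\<^sup>2 * (x\<^sup>2 + y\<^sup>2) + 2 * (real k)\<^sup>2 * x\<^sup>2"

definition symbol_B :: "nat \<Rightarrow> real \<Rightarrow> real \<Rightarrow> real" where
  "symbol_B k x y = (x\<^sup>2 + y\<^sup>2)\<^sup>2 + 2 * (real k)\<^sup>2 * x\<^sup>2 - real k ^ 4"

definition symbol_q :: "nat \<Rightarrow> real \<Rightarrow> real \<Rightarrow> real" where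
  "symbol_q k x y = 4 * speed k * (x\<^sup>2 + y\<^sup>2) * x"

definition lower_root :: "nat \<Rightarrow> real \<Rightarrow> real \<Rightarrow> real" where
  "lower_root k x y = 1 / 2 * (symbol_A k x y + symbol_B k x y
     - sqrt ((symbol_A k x y - symbol_B k x y)\<^sup>2 + 4 * (symbol_q k x y)\<^sup>2))"

definition upper_root :: "nat \<Rightarrow> real \<Rightarrow> real \<Rightarrow> real" where
  "upper_root k x y = 1 / 2 * (symbol_A k x y + symbol_B k x y
     + sqrt ((symbol_A k x y - symbol_B k x y)\<^sup>2 + 4 * (symbol_q k x y)\<^sup>2))"

lemma speed_sq: "(speed k)\<^sup>2 = (real k)\<^sup>2 / 2"
  by (simp add: speed_def power_divide)

lemma speed_pow4: "speed k ^ 4 = real k ^ 4 / 4"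
  using speed_sq[of k] by (simp add: speed_def power_divide power4_eq_xxxx)

lemma symbol_q_sq: "(symbol_q k x y)\<^sup>2 = 8 * (real k)\<^sup>2 * x\<^sup>2 * (x\<^sup>2 + y\<^sup>2)\<^sup>2"
  by (simp add: symbol_q_def power_mult_distrib speed_sq)

lemma lambda_minus_eq: "lambda_minus k m n = lower_root k (real m) (real n)"
proof -
  have "(symbol_A k x y - symbol_B k x y)\<^sup>2 + 4 * (symbol_q k x y)\<^sup>2 =
      real k ^ 8 + 2 * real k ^ 6 * (x\<^sup>2 + y\<^sup>2) + real k ^ 4 * (x\<^sup>2 + y\<^sup>2)\<^sup>2
        + 32 * (real k)\<^sup>2 * x\<^sup>2 * (x\<^sup>2 + y\<^sup>2)\<^sup>2" for x y
    unfolding symbol_q_sq symbol_A_def symbol_B_def by algebra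
  moreover have "symbol_A k x y + symbol_B k x y =
      - (real k ^ 4) + (real k)\<^sup>2 * (5 * x\<^sup>2 + y\<^sup>2) + 2 * (x\<^sup>2 + y\<^sup>2)\<^sup>2" for x y
    unfolding symbol_A_def symbol_B_def by algebra
  ultimately show ?thesis
    by (simp add: lambda_minus_def lower_root_def Let_def)
qed

lemma lower_root_abs: "lower_root k \<bar>x\<bar> \<bar>y\<bar> = lower_root k x y"
  by (simp add: lower_root_def symbol_q_sq symbol_A_def symbol_B_def)

lemma lower_upper_root:
  fixes k x y
  defines "A \<equiv> symbol_A k x y" and "B \<equiv> symbol_B k x y"
  shows "lower_root k x y + upper_root k x y = A + B"
    and "lower_root k x y * upper_root k x y = A * B - (symbol_q k x y)\<^sup>2"
    and "A \<le> upper_root k x y" "lower_root k x y \<le> B"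
proof -
  define S where "S = sqrt ((A - B)\<^sup>2 + 4 * (symbol_q k x y)\<^sup>2)"
  have l: "lower_root k x y = 1 / 2 * (A + B - S)" and u: "upper_root k x y = 1 / 2 * (A + B + S)"
    by (simp_all add: lower_root_def upper_root_def S_def A_def B_def)
  show "lower_root k x y + upper_root k x y = A + B" by (simp add: l u field_simps)
  have S: "S\<^sup>2 = (A - B)\<^sup>2 + 4 * (symbol_q k x y)\<^sup>2" by (simp add: S_def)
  have "2 * lower_root k x y = A + B - S" "2 * upper_root k x y = A + B + S"
    by (simp_all add: l u)
  then have "4 * (lower_root k x y * upper_root k x y) = (A + B)\<^sup>2 - S\<^sup>2"
    by algebra
  also have "\<dots> = 4 * (A * B - (symbol_q k x y)\<^sup>2)"
    unfolding S by (simp add: power2_eq_square algebra_simps)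
  finally show "lower_root k x y * upper_root k x y = A * B - (symbol_q k x y)\<^sup>2" by simp
  have "\<bar>A - B\<bar> \<le> S" unfolding S_def by (rule real_le_rsqrt) simp
  then show "A \<le> upper_root k x y" "lower_root k x y \<le> B"
    by (simp_all add: l u)
qed

text \<open>The hypothesis is the characteristic equation. If the first row of the singular matrix is nonzero,
  the vector orthogonal to it spans the kernel; otherwise \<open>(1, 0)\<close> lies in the kernel.\<close>

lemma eigenvector_exists:
  fixes A B q l :: real
  assumes "(A - l) * (B - l) = q\<^sup>2"
  shows "\<exists>\<alpha> \<beta>. \<alpha>\<^sup>2 + \<beta>\<^sup>2 = 1 \<and> A * \<alpha> + q * \<beta> = l * \<alpha> \<and> q * \<alpha> + B * \<beta> = l * \<beta>"
proof -
  obtain a b where ab: "a\<^sup>2 + b\<^sup>2 \<noteq> 0" "A * a + q * b = l * a" "q * a + B * b = l * b"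
  proof (cases "A = l \<and> q = 0")
    case True
    then show ?thesis using that[of 1 0] by simp
  next
    case False
    then have "q\<^sup>2 + (l - A)\<^sup>2 \<noteq> 0" by (auto simp: sum_power2_eq_zero_iff)
    moreover have "q * q + B * (l - A) = l * (l - A)"
      using assms by (simp add: power2_eq_square algebra_simps)
    ultimately show ?thesis using that[of q "l - A"] by (simp add: algebra_simps)
  qed
  define d where "d = sqrt (a\<^sup>2 + b\<^sup>2)"
  have "0 < a\<^sup>2 + b\<^sup>2" using ab(1) by (metis less_eq_real_def sum_power2_ge_zero)
  then have "0 < d" unfolding d_def by (rule real_sqrt_gt_zero)
  moreover have "d\<^sup>2 = a\<^sup>2 + b\<^sup>2" by (simp add: d_def)
  ultimately have d: "d \<noteq> 0" "d\<^sup>2 = a\<^sup>2 + b\<^sup>2" by simp_all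
  from d have "(a / d)\<^sup>2 + (b / d)\<^sup>2 = 1"
    unfolding power_divide add_divide_distrib[symmetric] by (simp only: d(2)[symmetric]) simp
  moreover have "A * (a / d) + q * (b / d) = l * (a / d)" "q * (a / d) + B * (b / d) = l * (b / d)"
    using ab(2,3) by (simp_all add: add_divide_distrib[symmetric])
  ultimately show ?thesis by blast
qed

text \<open>Taking the unit eigenvector of the upper root to be this one rotated by a right angle gives an
  orthonormal eigenbasis even where the two roots coincide.\<close>

definition lower_eigenvector :: "nat \<Rightarrow> real \<Rightarrow> real \<Rightarrow> real \<times> real" where
  "lower_eigenvector k x y = (SOME (\<alpha>, \<beta>). \<alpha>\<^sup>2 + \<beta>\<^sup>2 = 1 \<and>
     symbol_A k x y * \<alpha> + symbol_q k x y * \<beta> = lower_root k x y * \<alpha> \<and>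
     symbol_q k x y * \<alpha> + symbol_B k x y * \<beta> = lower_root k x y * \<beta>)"

lemma lower_eigenvector:
  assumes "lower_eigenvector k x y = (\<alpha>, \<beta>)"
  shows "\<alpha>\<^sup>2 + \<beta>\<^sup>2 = 1"
    "symbol_A k x y * \<alpha> + symbol_q k x y * \<beta> = lower_root k x y * \<alpha>"
    "symbol_q k x y * \<alpha> + symbol_B k x y * \<beta> = lower_root k x y * \<beta>"
proof -
  let ?P = "\<lambda>(\<alpha>, \<beta>). \<alpha>\<^sup>2 + \<beta>\<^sup>2 = 1 \<and>
     symbol_A k x y * \<alpha> + symbol_q k x y * \<beta> = lower_root k x y * \<alpha> \<and>
     symbol_q k x y * \<alpha> + symbol_B k x y * \<beta> = lower_root k x y * \<beta>"
  have "(symbol_A k x y - lower_root k x y) * (symbol_B k x y - lower_root k x y) = (symbol_q k x y)\<^sup>2"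
    using lower_upper_root(1,2)[of k x y] by algebra
  from eigenvector_exists[OF this] have "\<exists>v. ?P v" by auto
  then have "?P (lower_eigenvector k x y)" unfolding lower_eigenvector_def by (rule someI_ex)
  then show "\<alpha>\<^sup>2 + \<beta>\<^sup>2 = 1"
    "symbol_A k x y * \<alpha> + symbol_q k x y * \<beta> = lower_root k x y * \<alpha>"
    "symbol_q k x y * \<alpha> + symbol_B k x y * \<beta> = lower_root k x y * \<beta>"
    by (simp_all add: assms)
qed


section \<open>Eigenfunctions\<close>

text \<open>Modes are indexed by \<open>bool \<times> int \<times> int\<close>: the flag selects the lower or the upper root at a
  frequency.\<close>

fun mode_coeffs :: "nat \<Rightarrow> bool \<times> int \<times> int \<Rightarrow> real \<times> real" where
  "mode_coeffs k (lower, m, n) = (let (\<alpha>, \<beta>) = lower_eigenvector k (of_int m) (of_int n)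
     in if lower then (\<alpha>, \<beta>) else (- \<beta>, \<alpha>))"

fun mode_value :: "nat \<Rightarrow> bool \<times> int \<times> int \<Rightarrow> real" where
  "mode_value k (lower, m, n) =
     (if lower then lower_root k (of_int m) (of_int n) else upper_root k (of_int m) (of_int n))"

fun mode :: "nat \<Rightarrow> bool \<times> int \<times> int \<Rightarrow> real \<times> real \<Rightarrow> real ^ 3" where
  "mode k (lower, m, n) = frame k (\<lambda>p. fst (mode_coeffs k (lower, m, n)) * hartley m n p)
     (\<lambda>p. snd (mode_coeffs k (lower, m, n)) * hartley (- m) (- n) p)"

lemma mode_coeffs_eigen:
  assumes "mode_coeffs k (s, m, n) = (\<alpha>, \<beta>)"
  shows "symbol_A k (of_int m) (of_int n) * \<alpha> + symbol_q k (of_int m) (of_int n) * \<beta> = mode_value k (s, m, n) * \<alpha>"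
    "symbol_q k (of_int m) (of_int n) * \<alpha> + symbol_B k (of_int m) (of_int n) * \<beta> = mode_value k (s, m, n) * \<beta>"
proof -
  obtain a b where ab: "lower_eigenvector k (of_int m) (of_int n) = (a, b)" by force
  note e = lower_eigenvector[OF ab]
  have u: "upper_root k (of_int m) (of_int n) =
      symbol_A k (of_int m) (of_int n) + symbol_B k (of_int m) (of_int n) - lower_root k (of_int m) (of_int n)"
    using lower_upper_root(1)[of k "of_int m" "of_int n"] by simp
  show "symbol_A k (of_int m) (of_int n) * \<alpha> + symbol_q k (of_int m) (of_int n) * \<beta> = mode_value k (s, m, n) * \<alpha>"
    "symbol_q k (of_int m) (of_int n) * \<alpha> + symbol_B k (of_int m) (of_int n) * \<beta> = mode_value k (s, m, n) * \<beta>"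
    using assms e(2,3) by (auto simp: ab u algebra_simps split: if_splits)
qed

lemma mode_coeffs_orthonormal:
  "fst (mode_coeffs k (s, m, n)) * fst (mode_coeffs k (s', m, n))
    + snd (mode_coeffs k (s, m, n)) * snd (mode_coeffs k (s', m, n)) = (if s = s' then 1 else 0)"
proof -
  obtain a b where ab: "lower_eigenvector k (of_int m) (of_int n) = (a, b)" by force
  show ?thesis
    using lower_eigenvector(1)[OF ab] by (auto simp: ab power2_eq_square)
qed

definition pairing :: "(real \<times> real \<Rightarrow> real ^ 3) \<Rightarrow> (real \<times> real \<Rightarrow> real ^ 3) \<Rightarrow> real" where
  "pairing V W = torus_integral (\<lambda>p. V p \<bullet> W p)"

lemma mode_in_sections: "mode k j \<in> sections (phi k)"
proof (cases j)
  case (fields s m n)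
  have "torus_periodic (\<lambda>p. c * hartley i l p)" for c i l
    using torus_periodic_hartley[of i l] by (simp add: torus_periodic_def)
  then show ?thesis
    unfolding fields mode.simps by (intro frame_in_sections smooth_mult smooth_const smooth_hartley)
qed

lemma pairing_frame_mode:
  assumes "smooth a" "smooth b"
  shows "pairing (frame k a b) (mode k (s, m, n)) =
    fst (mode_coeffs k (s, m, n)) * hartley_coeff m n a
    + snd (mode_coeffs k (s, m, n)) * hartley_coeff (- m) (- n) b"
proof -
  have "pairing (frame k a b) (mode k (s, m, n)) =
      torus_integral (\<lambda>p. fst (mode_coeffs k (s, m, n)) * (a p * hartley m n p)
        + snd (mode_coeffs k (s, m, n)) * (b p * hartley (- m) (- n) p))"
    unfolding pairing_def mode.simps inner_frame by (simp add: mult.left_commute)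
  also have "\<dots> = fst (mode_coeffs k (s, m, n)) * hartley_coeff m n a
    + snd (mode_coeffs k (s, m, n)) * hartley_coeff (- m) (- n) b"
    unfolding hartley_coeff_def torus_integral_cmult[symmetric]
    by (intro torus_integral_add smooth_continuous_on smooth_mult smooth_const smooth_hartley assms)
  finally show ?thesis .
qed

lemma pairing_mode: "pairing (mode k i) (mode k j) = (if i = j then (2 * pi)\<^sup>2 else 0)"
proof -
  obtain s m n where i: "i = (s, m, n)" by (cases i)
  obtain s' m' n' where j: "j = (s', m', n')" by (cases j)
  have "pairing (mode k i) (mode k j) =
      (fst (mode_coeffs k i) * fst (mode_coeffs k j) + snd (mode_coeffs k i) * snd (mode_coeffs k j))
        * (if m' = m \<and> n' = n then (2 * pi)\<^sup>2 else 0)"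
    unfolding i j mode.simps(1)[of k s]
    by (simp add: pairing_frame_mode smooth_mult smooth_const smooth_hartley
        hartley_coeff_cmult hartley_coeff_hartley del: mode.simps mode_coeffs.simps)
      (simp add: algebra_simps del: mode_coeffs.simps)
  also have "\<dots> = (if i = j then (2 * pi)\<^sup>2 else 0)"
    unfolding i j using mode_coeffs_orthonormal[of k s m n s'] by (auto simp del: mode_coeffs.simps)
  finally show ?thesis .
qed

text \<open>At each frequency the two modes are independent combinations of the same two Hartley functions, so
  both components have no Hartley coefficients.\<close>

lemma section_eq_0:
  assumes "V \<in> sections (phi k)" "\<And>j. pairing V (mode k j) = 0"
  shows "V = 0"
proof -
  obtain a b where V: "V = frame k a b" "smooth a" "torus_periodic a" "smooth b" "torus_periodic b"
    using sections_frameE[OF assms(1)] .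
  have coeff: "hartley_coeff m n a = 0 \<and> hartley_coeff (- m) (- n) b = 0" for m n
  proof -
    obtain \<alpha> \<beta> where ab: "lower_eigenvector k (of_int m) (of_int n) = (\<alpha>, \<beta>)" by force
    have "\<alpha> * hartley_coeff m n a + \<beta> * hartley_coeff (- m) (- n) b = 0"
      "- \<beta> * hartley_coeff m n a + \<alpha> * hartley_coeff (- m) (- n) b = 0"
      using assms(2)[of "(True, m, n)"] assms(2)[of "(False, m, n)"]
      unfolding V(1) pairing_frame_mode[OF V(2,4)] by (simp_all add: ab)
    with lower_eigenvector(1)[OF ab] show ?thesis by algebra
  qed
  have "hartley_coeff m n a = 0" "hartley_coeff m n b = 0" for m n
    using coeff[of m n] coeff[of "- m" "- n"] by simp_all
  note hartley_complete[OF smooth_continuous_on[OF V(2)] V(3) this(1)]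
    hartley_complete[OF smooth_continuous_on[OF V(4)] V(5) this(2)]
  then show ?thesis by (auto simp: V(1) frame_def)
qed

lemma hartley_coeff_lap:
  assumes "smooth f" "torus_periodic f"
  shows "hartley_coeff m n (lap f) = ((of_int m)\<^sup>2 + (of_int n)\<^sup>2) * hartley_coeff m n f"
proof -
  note d = smooth_pderiv_dir[OF assms(1)] torus_periodic_pderiv_dir[OF assms]
  have "lap f = (\<lambda>p. (- 1) * (pderiv_dir (1, 0) (pderiv_dir (1, 0) f) p + pderiv_dir (0, 1) (pderiv_dir (0, 1) f) p))"
    by (auto simp: lap_def)
  then have "hartley_coeff m n (lap f) = (- 1) *
      (hartley_coeff m n (pderiv_dir (1, 0) (pderiv_dir (1, 0) f)) + hartley_coeff m n (pderiv_dir (0, 1) (pderiv_dir (0, 1) f)))"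
    by (simp only: hartley_coeff_cmult hartley_coeff_add smooth_continuous_on smooth_pderiv_dir assms)
  then show ?thesis
    by (simp add: hartley_coeff_pderiv_dir d assms power2_eq_square algebra_simps)
qed

text \<open>Passing to coefficients turns \<open>lap\<close> into multiplication by \<open>m\<^sup>2 + n\<^sup>2\<close> and \<open>\<partial>\<^sub>\<gamma>\<close> into
  multiplication by \<open>- m\<close> combined with reflection of the frequency, which is why the second component
  is tested at \<open>(- m, - n)\<close>.\<close>

lemma second_variation_symmetric:
  assumes "V \<in> sections (phi k)"
  shows "second_variation (phi k) V \<in> sections (phi k)"
    and "pairing (second_variation (phi k) V) (mode k j) = mode_value k j * pairing V (mode k j)"
proof -
  obtain a b where V: "V = frame k a b" "smooth a" "torus_periodic a" "smooth b" "torus_periodic b"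
    using sections_frameE[OF assms(1)] .
  define IX where "IX = (\<lambda>p. lap (lap a) p + 2 * (speed k)\<^sup>2 * lap a p
      - 4 * (speed k)\<^sup>2 * pderiv_dir (1, 0) (pderiv_dir (1, 0) a) p
      - 2 * speed k * (lap (pderiv_dir (1, 0) b) p + pderiv_dir (1, 0) (lap b) p))"
  define IY where "IY = (\<lambda>p. lap (lap b) p - 4 * (speed k)\<^sup>2 * pderiv_dir (1, 0) (pderiv_dir (1, 0) b) p
      - 4 * (speed k)^4 * b p
      + 2 * speed k * (lap (pderiv_dir (1, 0) a) p + pderiv_dir (1, 0) (lap a) p))"
  have I: "second_variation (phi k) V = frame k IX IY"
    unfolding V(1) IX_def IY_def by (rule second_variation_frame[OF V(2,4)])
  have s: "smooth IX" "smooth IY"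
    unfolding IX_def IY_def by (intro smooth_intros V)+
  note per = torus_periodic_lap torus_periodic_pderiv_dir smooth_lap smooth_pderiv_dir V
  have "torus_periodic (lap (lap a))" "torus_periodic (lap a)" "torus_periodic (pderiv_dir (1, 0) (pderiv_dir (1, 0) a))"
    "torus_periodic (lap (pderiv_dir (1, 0) b))" "torus_periodic (pderiv_dir (1, 0) (lap b))"
    "torus_periodic (lap (lap b))" "torus_periodic (pderiv_dir (1, 0) (pderiv_dir (1, 0) b))"
    "torus_periodic (lap (pderiv_dir (1, 0) a))" "torus_periodic (pderiv_dir (1, 0) (lap a))"
    by (intro per)+
  then have t: "torus_periodic IX" "torus_periodic IY"
    using V(5) by (simp_all add: IX_def IY_def torus_periodic_def)
  show "second_variation (phi k) V \<in> sections (phi k)"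
    unfolding I by (rule frame_in_sections[OF s(1) t(1) s(2) t(2)])
  obtain \<sigma> m n where j: "j = (\<sigma>, m, n)" by (cases j)
  obtain \<alpha> \<beta> where ab: "mode_coeffs k (\<sigma>, m, n) = (\<alpha>, \<beta>)" by force
  define u w where "u = hartley_coeff m n a" and "w = hartley_coeff (- m) (- n) b"
  note coeff = hartley_coeff_add hartley_coeff_diff hartley_coeff_cmult hartley_coeff_lap
    hartley_coeff_pderiv_dir
  note c = smooth_continuous_on smooth_intros per
  have sq: "speed k * (speed k * z) = real k * (real k * z) / 2" for z
    using speed_sq[of k] by (simp add: power2_eq_square mult.assoc[symmetric])
  have "hartley_coeff m n IX = symbol_A k (of_int m) (of_int n) * u + symbol_q k (of_int m) (of_int n) * w"
    unfolding IX_def u_def w_def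
    by (simp add: coeff c) (simp add: symbol_A_def symbol_q_def sq algebra_simps power2_eq_square)
  moreover have "hartley_coeff (- m) (- n) IY = symbol_q k (of_int m) (of_int n) * u + symbol_B k (of_int m) (of_int n) * w"
    unfolding IY_def u_def w_def
    by (simp add: coeff c) (simp add: symbol_B_def symbol_q_def sq speed_pow4 algebra_simps power2_eq_square)
  ultimately have "pairing (second_variation (phi k) V) (mode k j) =
      (symbol_A k (of_int m) (of_int n) * \<alpha> + symbol_q k (of_int m) (of_int n) * \<beta>) * u
      + (symbol_q k (of_int m) (of_int n) * \<alpha> + symbol_B k (of_int m) (of_int n) * \<beta>) * w"
    unfolding I j pairing_frame_mode[OF s] ab by (simp add: algebra_simps)
  moreover have "pairing V (mode k j) = \<alpha> * u + \<beta> * w"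
    unfolding V(1) j pairing_frame_mode[OF V(2,4)] ab u_def w_def by simp
  ultimately show "pairing (second_variation (phi k) V) (mode k j) = mode_value k j * pairing V (mode k j)"
    unfolding mode_coeffs_eigen[OF ab] j by (simp only: distrib_left mult.assoc)
qed


section \<open>Eigenspaces\<close>

declare mode.simps [simp del] mode_value.simps [simp del]

lemma subspace_sections: "subspace (sections \<phi>)"
  unfolding subspace_def
proof (intro conjI ballI allI)
  show "0 \<in> sections \<phi>"
    using smooth_const[of 0] by (simp add: sections_def torus_periodic_def zero_fun_def)
  fix V assume V: "V \<in> sections \<phi>"
  show "V + W \<in> sections \<phi>" if "W \<in> sections \<phi>" for W
    using V that smooth_add[of V W]
    by (auto simp: sections_def torus_periodic_def plus_fun_def inner_add_left)
  show "c *\<^sub>R V \<in> sections \<phi>" for c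
    using V smooth_scaleR[OF smooth_const, of V c]
    by (auto simp: sections_def torus_periodic_def scaleR_fun_def)
qed

lemma pairing_lincomb:
  assumes "V \<in> sections \<phi>" "W \<in> sections \<phi>" "Z \<in> sections \<phi>"
  shows "pairing (V + W) Z = pairing V Z + pairing W Z" "pairing (V - W) Z = pairing V Z - pairing W Z"
    and "pairing (c *\<^sub>R V) Z = c * pairing V Z"
proof -
  have "continuous_on UNIV (\<lambda>p. V p \<bullet> Z p)" "continuous_on UNIV (\<lambda>p. W p \<bullet> Z p)"
    using assms by (auto simp: sections_def intro!: smooth_continuous_on smooth_inner)
  then show "pairing (V + W) Z = pairing V Z + pairing W Z" "pairing (V - W) Z = pairing V Z - pairing W Z"
    by (simp_all add: pairing_def inner_add_left inner_diff_left torus_integral_add torus_integral_diff)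
  show "pairing (c *\<^sub>R V) Z = c * pairing V Z"
    by (simp add: pairing_def scaleR_fun_def torus_integral_cmult)
qed

lemma pairing_sum:
  assumes "finite F"
  shows "(\<Sum>i\<in>F. c i *\<^sub>R mode k i) \<in> sections (phi k)"
    and "pairing (\<Sum>i\<in>F. c i *\<^sub>R mode k i) (mode k j) = (if j \<in> F then c j * (2 * pi)\<^sup>2 else 0)"
proof -
  note sub = subspace_sections[of "phi k"]
  show S: "(\<Sum>i\<in>F. c i *\<^sub>R mode k i) \<in> sections (phi k)" for F
    by (intro subspace_sum sub subspace_scale mode_in_sections)
  show "pairing (\<Sum>i\<in>F. c i *\<^sub>R mode k i) (mode k j) = (if j \<in> F then c j * (2 * pi)\<^sup>2 else 0)"
    using assms
  proof (induction F)
    case empty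
    then show ?case by (simp add: pairing_def torus_integral_def)
  next
    case (insert i F)
    show ?case
      unfolding sum.insert[OF insert.hyps]
        pairing_lincomb(1)[OF subspace_scale[OF sub mode_in_sections] S mode_in_sections]
        pairing_lincomb(3)[OF mode_in_sections mode_in_sections mode_in_sections] insert.IH pairing_mode
      using insert.hyps by auto
  qed
qed

text \<open>By completeness \<open>I\<^sub>2 V = \<mu> V\<close> may be tested against the modes, on which \<open>I\<^sub>2\<close> is symmetric. In
  this form it is evident that eigenspaces are subspaces and that each mode is an eigenfunction.\<close>

lemma eigenspace_iff:
  "V \<in> eigenspace (phi k) \<mu> \<longleftrightarrow>
    V \<in> sections (phi k) \<and> (\<forall>j. mode_value k j \<noteq> \<mu> \<longrightarrow> pairing V (mode k j) = 0)"
proof (cases "V \<in> sections (phi k)")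
  case True
  note S = True second_variation_symmetric(1)[OF True]
  note sub = subspace_sections[of "phi k"]
  have "V \<in> eigenspace (phi k) \<mu> \<longleftrightarrow> second_variation (phi k) V - \<mu> *\<^sub>R V = 0"
    using True by (auto simp: eigenspace_def fun_eq_iff scaleR_fun_def)
  also have "\<dots> \<longleftrightarrow> (\<forall>j. pairing (second_variation (phi k) V - \<mu> *\<^sub>R V) (mode k j) = 0)"
    using section_eq_0[OF subspace_diff[OF sub S(2) subspace_scale[OF sub S(1)]]]
    by (metis pairing_sum(2)[OF finite.emptyI, of "\<lambda>_. 0"] sum.empty empty_iff)
  also have "\<dots> \<longleftrightarrow> (\<forall>j. (mode_value k j - \<mu>) * pairing V (mode k j) = 0)"
    by (simp add: pairing_lincomb[OF S(2) subspace_scale[OF sub S(1)] mode_in_sections]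
        pairing_lincomb(3)[OF S(1) S(1) mode_in_sections] second_variation_symmetric(2)[OF True] left_diff_distrib)
  finally show ?thesis using True by auto
qed (simp add: eigenspace_def)

text \<open>Subtracting from an eigenfunction its projection onto the finitely many modes of the same eigenvalue
  leaves a section without pairings with any mode, that is zero.\<close>

lemma eigenspace_eq_span:
  assumes "finite {j. mode_value k j = \<mu>}"
  shows "eigenspace (phi k) \<mu> = span (mode k ` {j. mode_value k j = \<mu>})"
proof
  let ?F = "{j. mode_value k j = \<mu>}"
  note sub = subspace_sections[of "phi k"]
  show "eigenspace (phi k) \<mu> \<subseteq> span (mode k ` ?F)"
  proof
    fix V assume "V \<in> eigenspace (phi k) \<mu>"
    then have V: "V \<in> sections (phi k)" "\<And>j. mode_value k j \<noteq> \<mu> \<Longrightarrow> pairing V (mode k j) = 0"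
      by (auto simp: eigenspace_iff)
    let ?W = "\<Sum>j\<in>?F. (pairing V (mode k j) / (2 * pi)\<^sup>2) *\<^sub>R mode k j"
    have "V - ?W = 0"
    proof (rule section_eq_0)
      show "V - ?W \<in> sections (phi k)"
        by (intro subspace_diff sub V pairing_sum assms)
      show "pairing (V - ?W) (mode k j) = 0" for j
        unfolding pairing_lincomb(2)[OF V(1) pairing_sum(1)[OF assms] mode_in_sections]
          pairing_sum(2)[OF assms] using V(2)[of j] by simp
    qed
    then have "V = ?W" by simp
    also have "?W \<in> span (mode k ` ?F)"
      by (intro span_sum span_scale span_base imageI)
    finally show "V \<in> span (mode k ` ?F)" .
  qed
  have "subspace (eigenspace (phi k) \<mu>)"
    unfolding subspace_def
    using subspace_0[OF sub] subspace_add[OF sub] subspace_scale[OF sub]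
      pairing_lincomb[OF _ _ mode_in_sections]
    by (auto simp: eigenspace_iff pairing_def torus_integral_def) 
  moreover have "mode k ` ?F \<subseteq> eigenspace (phi k) \<mu>"
    by (auto simp: eigenspace_iff mode_in_sections pairing_mode)
  ultimately show "span (mode k ` ?F) \<subseteq> eigenspace (phi k) \<mu>"
    by (intro span_minimal)
qed

lemma inj_mode: "inj (mode k)"
proof (rule injI, rule ccontr)
  fix i j assume "mode k i = mode k j" "i \<noteq> j"
  then show False using pairing_mode[of k i j] pairing_mode[of k i i] by simp
qed

lemma independent_modes:
  assumes "finite F"
  shows "independent (mode k ` F)"
proof (rule independent_if_scalars_zero)
  show "finite (mode k ` F)" using assms by simp
  fix f V assume f: "(\<Sum>V\<in>mode k ` F. f V *\<^sub>R V) = 0" and V: "V \<in> mode k ` F"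
  obtain j where j: "j \<in> F" "V = mode k j" using V by blast
  have "(\<Sum>i\<in>F. f (mode k i) *\<^sub>R mode k i) = (\<Sum>i\<in>{}. 0 *\<^sub>R mode k i)"
    using f sum.reindex[of "mode k" F "\<lambda>V. f V *\<^sub>R V", OF inj_on_subset[OF inj_mode subset_UNIV]]
    by simp
  then have "f (mode k j) * (2 * pi)\<^sup>2 = 0"
    using pairing_sum(2)[OF assms, of "\<lambda>i. f (mode k i)" k j]
      pairing_sum(2)[OF finite.emptyI, of "\<lambda>i. 0" k j] j(1) by simp
  then show "f V = 0" by (simp add: j(2))
qed

lemma edim_eigenspace:
  assumes "finite {j. mode_value k j = \<mu>}"
  shows "edim (eigenspace (phi k) \<mu>) = enat (card {j. mode_value k j = \<mu>})"
proof -
  let ?B = "mode k ` {j. mode_value k j = \<mu>}"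
  have "dim (span ?B) = card ?B"
    by (rule dim_span_eq_card_independent[OF independent_modes[OF assms]])
  also have "card ?B = card {j. mode_value k j = \<mu>}"
    by (rule card_image[OF inj_on_subset[OF inj_mode subset_UNIV]])
  finally show ?thesis
    unfolding edim_def eigenspace_eq_span[OF assms] using assms by auto
qed

lemma bi_nullity_eq_card:
  assumes "finite {j. mode_value k j = 0}"
  shows "bi_nullity (phi k) = enat (card {j. mode_value k j = 0})"
proof -
  have "{V \<in> sections (phi k). \<forall>p. second_variation (phi k) V p = 0} = eigenspace (phi k) 0"
    by (simp add: eigenspace_def)
  then show ?thesis by (simp add: bi_nullity_def edim_eigenspace[OF assms])
qed

text \<open>Different frequencies may share an eigenvalue; summing the dimensions over the eigenvalues
  counts each negative mode once.\<close>

lemma bi_index_eq_card: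
  assumes "finite {j. mode_value k j < 0}"
  shows "bi_index (phi k) = enat (card {j. mode_value k j < 0})"
proof -
  let ?N = "{j. mode_value k j < 0}"
  have fin: "finite {j. mode_value k j = \<mu>}" if "\<mu> < 0" for \<mu>
    by (rule finite_subset[OF _ assms]) (use that in auto)
  have nontrivial: "(\<exists>V\<in>eigenspace (phi k) \<mu>. V \<noteq> 0) \<longleftrightarrow> (\<exists>j. mode_value k j = \<mu>)" if "\<mu> < 0" for \<mu>
  proof
    assume "\<exists>V\<in>eigenspace (phi k) \<mu>. V \<noteq> 0"
    then show "\<exists>j. mode_value k j = \<mu>"
      unfolding eigenspace_eq_span[OF fin[OF that]] by (cases "{j. mode_value k j = \<mu>} = {}") auto
  next
    assume "\<exists>j. mode_value k j = \<mu>"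
    then obtain j where j: "mode_value k j = \<mu>" by blast
    then have "mode k j \<in> eigenspace (phi k) \<mu>"
      unfolding eigenspace_eq_span[OF fin[OF that]] by (intro span_base) auto
    moreover have "mode k j \<noteq> 0"
      using independent_modes[of "{j}" k] by (metis finite.emptyI finite_insert image_insert image_empty dependent_single)
    ultimately show "\<exists>V\<in>eigenspace (phi k) \<mu>. V \<noteq> 0" by blast
  qed
  have neg: "negative_eigenvalues (phi k) = mode_value k ` ?N"
  proof (intro set_eqI)
    fix \<mu>
    have "\<mu> \<in> negative_eigenvalues (phi k) \<longleftrightarrow> \<mu> < 0 \<and> (\<exists>j. mode_value k j = \<mu>)"
      unfolding negative_eigenvalues_def mem_Collect_eq using nontrivial[of \<mu>] by (rule conj_cong[OF refl])
    then show "\<mu> \<in> negative_eigenvalues (phi k) \<longleftrightarrow> \<mu> \<in> mode_value k ` ?N"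
      by auto
  qed
  have sum_enat: "(\<Sum>\<mu>\<in>A. enat (g \<mu>)) = enat (\<Sum>\<mu>\<in>A. g \<mu>)" for A :: "real set" and g
    by (induction A rule: infinite_finite_induct) (auto simp: zero_enat_def)
  have "bi_index (phi k) = (\<Sum>\<mu>\<in>mode_value k ` ?N. edim (eigenspace (phi k) \<mu>))"
    using assms by (simp add: bi_index_def neg)
  also have "\<dots> = (\<Sum>\<mu>\<in>mode_value k ` ?N. enat (card {j \<in> ?N. mode_value k j = \<mu>}))"
  proof (rule sum.cong[OF refl])
    fix \<mu> assume "\<mu> \<in> mode_value k ` ?N"
    then have "\<mu> < 0" by blast
    then have "{j. mode_value k j = \<mu>} = {j \<in> ?N. mode_value k j = \<mu>}" by auto
    then show "edim (eigenspace (phi k) \<mu>) = enat (card {j \<in> ?N. mode_value k j = \<mu>})"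
      using edim_eigenspace[OF fin[OF \<open>\<mu> < 0\<close>]] by simp
  qed
  also have "\<dots> = enat (card ?N)"
    unfolding sum_enat using sum.image_gen[OF assms, of "\<lambda>_. 1::nat" "mode_value k"] by simp
  finally show ?thesis .
qed


section \<open>Counting modes\<close>

lemma symbol_A_pos: "x \<noteq> 0 \<or> y \<noteq> 0 \<Longrightarrow> 0 < symbol_A k x y"
proof -
  assume "x \<noteq> 0 \<or> y \<noteq> 0"
  then have "x\<^sup>2 + y\<^sup>2 \<noteq> 0" by (simp add: sum_power2_eq_zero_iff)
  then have "0 < (x\<^sup>2 + y\<^sup>2)\<^sup>2" by simp
  moreover have "0 \<le> (real k)\<^sup>2 * (x\<^sup>2 + y\<^sup>2) + 2 * (real k)\<^sup>2 * x\<^sup>2" by simp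
  ultimately show ?thesis unfolding symbol_A_def by linarith
qed

lemma upper_root_pos: "x \<noteq> 0 \<or> y \<noteq> 0 \<Longrightarrow> 0 < upper_root k x y"
  using symbol_A_pos[of x y k] lower_upper_root(3)[where k=k and x=x and y=y] by linarith

lemma lower_root_sign:
  assumes "x \<noteq> 0 \<or> y \<noteq> 0"
  shows "lower_root k x y < 0 \<longleftrightarrow> symbol_A k x y * symbol_B k x y < (symbol_q k x y)\<^sup>2"
    and "lower_root k x y = 0 \<longleftrightarrow> symbol_A k x y * symbol_B k x y = (symbol_q k x y)\<^sup>2"
proof -
  have "0 < upper_root k x y" by (rule upper_root_pos[OF assms])
  then have "lower_root k x y < 0 \<longleftrightarrow> lower_root k x y * upper_root k x y < 0"
    "lower_root k x y = 0 \<longleftrightarrow> lower_root k x y * upper_root k x y = 0"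
    by (auto simp: mult_less_0_iff)
  then show "lower_root k x y < 0 \<longleftrightarrow> symbol_A k x y * symbol_B k x y < (symbol_q k x y)\<^sup>2"
    "lower_root k x y = 0 \<longleftrightarrow> symbol_A k x y * symbol_B k x y = (symbol_q k x y)\<^sup>2"
    unfolding lower_upper_root(2) by simp_all
qed

lemma lower_root_0: "lower_root k 0 0 = - (real k ^ 4)" "upper_root k 0 0 = 0"
proof -
  have "symbol_A k 0 0 = 0" "symbol_q k 0 0 = 0" "symbol_B k 0 0 = - (real k ^ 4)"
    by (simp_all add: symbol_A_def symbol_q_def symbol_B_def)
  with lower_upper_root[of k 0 0] have "lower_root k 0 0 + upper_root k 0 0 = - (real k ^ 4)"
    "lower_root k 0 0 * upper_root k 0 0 = 0" "0 \<le> upper_root k 0 0"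
    by simp_all
  moreover have "0 \<le> real k ^ 4" by simp
  ultimately show "lower_root k 0 0 = - (real k ^ 4)" "upper_root k 0 0 = 0"
    by auto
qed

lemma real_power_iff:
  assumes "0 < e"
  shows "real a ^ e < real b ^ e \<longleftrightarrow> a < b" "real a ^ e = real b ^ e \<longleftrightarrow> a = b"
proof -
  have "real b ^ e \<le> real a ^ e \<longleftrightarrow> b \<le> a" using assms by (subst power_mono_iff) auto
  then show "real a ^ e < real b ^ e \<longleftrightarrow> a < b" by (metis not_le)
  show "real a ^ e = real b ^ e \<longleftrightarrow> a = b" using assms by (subst power_eq_iff_eq_base) auto
qed

text \<open>With \<open>\<xi> = m\<^sup>2\<close> and \<open>K = k\<^sup>2\<close>, \<open>A B - q\<^sup>2\<close> factors as \<open>\<xi> ((\<xi> - K)\<^sup>2 + 2 K\<^sup>2) (\<xi> - K)\<close>.\<close>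

lemma lower_root_x_axis:
  assumes "1 \<le> k" "1 \<le> m"
  shows "lower_root k (real m) 0 < 0 \<longleftrightarrow> m < k" "lower_root k (real m) 0 = 0 \<longleftrightarrow> m = k"
proof -
  define x where "x = (real m)\<^sup>2"
  define K where "K = (real k)\<^sup>2"
  have "symbol_A k (real m) 0 * symbol_B k (real m) 0 - (symbol_q k (real m) 0)\<^sup>2 =
      x * ((x - K)\<^sup>2 + 2 * K\<^sup>2) * (x - K)"
  proof -
    have "symbol_A k (real m) 0 = x\<^sup>2 + 3 * K * x" "symbol_B k (real m) 0 = x\<^sup>2 + 2 * K * x - K\<^sup>2"
      "(symbol_q k (real m) 0)\<^sup>2 = 8 * K * x * x\<^sup>2"
      by (simp_all add: symbol_q_sq symbol_A_def symbol_B_def x_def K_def power_mult[symmetric])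
    then show ?thesis by algebra
  qed
  moreover have "0 < x * ((x - K)\<^sup>2 + 2 * K\<^sup>2)"
    using assms by (intro mult_pos_pos add_nonneg_pos) (auto simp: x_def K_def)
  moreover have "x < K \<longleftrightarrow> m < k" "x = K \<longleftrightarrow> m = k"
    unfolding x_def K_def by (rule real_power_iff; simp)+
  moreover have "u * v < 0 \<longleftrightarrow> v < 0" "u * v = 0 \<longleftrightarrow> v = 0" if "0 < u" for u v :: real
    using that by (auto simp: mult_less_0_iff)
  ultimately have "symbol_A k (real m) 0 * symbol_B k (real m) 0 - (symbol_q k (real m) 0)\<^sup>2 < 0 \<longleftrightarrow> m < k"
    "symbol_A k (real m) 0 * symbol_B k (real m) 0 - (symbol_q k (real m) 0)\<^sup>2 = 0 \<longleftrightarrow> m = k"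
    by (metis diff_less_0_iff_less, metis eq_iff_diff_eq_0)
  then show "lower_root k (real m) 0 < 0 \<longleftrightarrow> m < k" "lower_root k (real m) 0 = 0 \<longleftrightarrow> m = k"
    using lower_root_sign[of "real m" 0 k] assms by simp_all
qed

lemma lower_root_y_axis:
  assumes "1 \<le> k" "1 \<le> n"
  shows "lower_root k 0 (real n) < 0 \<longleftrightarrow> n < k" "lower_root k 0 (real n) = 0 \<longleftrightarrow> n = k"
proof -
  have "symbol_q k 0 (real n) = 0" "symbol_B k 0 (real n) = real n ^ 4 - real k ^ 4"
    by (simp_all add: symbol_q_def symbol_B_def power_mult[symmetric])
  moreover have "0 < symbol_A k 0 (real n)" using assms by (intro symbol_A_pos) simp
  moreover have "real n ^ 4 < real k ^ 4 \<longleftrightarrow> n < k" "real n ^ 4 = real k ^ 4 \<longleftrightarrow> n = k"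
    by (rule real_power_iff; simp)+
  ultimately show "lower_root k 0 (real n) < 0 \<longleftrightarrow> n < k" "lower_root k 0 (real n) = 0 \<longleftrightarrow> n = k"
    using lower_root_sign[of 0 "real n" k] assms by (simp_all add: mult_less_0_iff)
qed

text \<open>With \<open>r = x\<^sup>2 + y\<^sup>2\<close> and \<open>K = k\<^sup>2\<close> the determinant \<open>A B - q\<^sup>2\<close> is the square
  \<open>(r\<^sup>2 - 2 K x\<^sup>2)\<^sup>2\<close> plus terms that are positive for \<open>r \<ge> 2 K\<close>. This bounds the frequencies with a
  nonpositive eigenvalue.\<close>

lemma lower_root_pos:
  assumes "1 \<le> k" "2 * (real k)\<^sup>2 \<le> x\<^sup>2 + y\<^sup>2"
  shows "0 < lower_root k x y"
proof -
  define K where "K = (real k)\<^sup>2"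
  define r where "r = x\<^sup>2 + y\<^sup>2"
  have K: "0 < K" "2 * K \<le> r" using assms by (simp_all add: K_def r_def)
  have xy: "x \<noteq> 0 \<or> y \<noteq> 0" using K by (auto simp: r_def)
  have "0 < K * r * ((r - 2 * K) * (r + K) + K\<^sup>2)"
    using K by (intro mult_pos_pos add_nonneg_pos mult_nonneg_nonneg) auto
  moreover have "0 \<le> K * (r - K) * (2 * K * x\<^sup>2)"
    using K by (intro mult_nonneg_nonneg) auto
  moreover have "symbol_A k x y * symbol_B k x y - (symbol_q k x y)\<^sup>2 =
      (r\<^sup>2 - 2 * K * x\<^sup>2)\<^sup>2
        + K * (r - K) * (2 * K * x\<^sup>2) + K * r * ((r - 2 * K) * (r + K) + K\<^sup>2)"
    unfolding symbol_q_sq symbol_A_def symbol_B_def r_def K_def by algebra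
  ultimately have "(symbol_q k x y)\<^sup>2 < symbol_A k x y * symbol_B k x y"
    using zero_le_power2[of "r\<^sup>2 - 2 * K * x\<^sup>2"] by linarith
  then show ?thesis using lower_root_sign[OF xy, of k] by linarith
qed

lemma finite_lambda_minus_nonpos:
  assumes "1 \<le> k"
  shows "finite {(m, n). lambda_minus k m n \<le> 0}"
proof (rule finite_subset)
  show "{(m, n). lambda_minus k m n \<le> 0} \<subseteq> {..2 * k\<^sup>2} \<times> {..2 * k\<^sup>2}"
  proof (clarsimp, rule ccontr)
    fix m n assume l: "lambda_minus k m n \<le> 0" and "\<not> (m \<le> 2 * k\<^sup>2 \<and> n \<le> 2 * k\<^sup>2)"
    then have "2 * k\<^sup>2 \<le> m \<or> 2 * k\<^sup>2 \<le> n" by linarith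
    moreover have "m \<le> m\<^sup>2" "n \<le> n\<^sup>2" by (simp_all add: power2_eq_square)
    ultimately have "2 * k\<^sup>2 \<le> m\<^sup>2 + n\<^sup>2" by linarith
    then have "real (2 * k\<^sup>2) \<le> real (m\<^sup>2 + n\<^sup>2)" by (rule of_nat_mono)
    then have "2 * (real k)\<^sup>2 \<le> (real m)\<^sup>2 + (real n)\<^sup>2" by simp
    from lower_root_pos[OF assms this] l show False by (simp add: lambda_minus_eq)
  qed
qed simp

text \<open>The fibre of \<open>(i, j) \<mapsto> (\<bar>i\<bar>, \<bar>j\<bar>)\<close> has one element at the origin, two on the half-axes and four
  elsewhere.\<close>

lemma card_int_pairs_by_abs:
  fixes P :: "nat \<Rightarrow> nat \<Rightarrow> bool"
  assumes "finite {(m, n). P m n}"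
  shows "finite {(i :: int, j :: int). P (nat \<bar>i\<bar>) (nat \<bar>j\<bar>)}" (is "finite ?S")
    and "card {(i :: int, j :: int). P (nat \<bar>i\<bar>) (nat \<bar>j\<bar>)} =
      (if P 0 0 then 1 else 0) + 2 * card {m. 1 \<le> m \<and> P m 0} + 2 * card {n. 1 \<le> n \<and> P 0 n}
      + 4 * card {(m, n). 1 \<le> m \<and> 1 \<le> n \<and> P m n}"
proof -
  let ?T = "{(m, n). P m n}"
  define fib where "fib = (\<lambda>(m, n). {int m, - int m} \<times> {int n, - int n})"
  have S: "?S = (\<Union>t\<in>?T. fib t)"
  proof (intro set_eqI iffI)
    fix z assume "z \<in> ?S"
    then obtain i j where "z = (i, j)" "P (nat \<bar>i\<bar>) (nat \<bar>j\<bar>)" by blast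
    then show "z \<in> (\<Union>t\<in>?T. fib t)"
      by (intro UN_I[of "(nat \<bar>i\<bar>, nat \<bar>j\<bar>)"]) (auto simp: fib_def)
  qed (auto simp: fib_def)
  have fin: "finite (fib t)" for t by (simp add: fib_def case_prod_unfold)
  show "finite ?S" unfolding S by (intro finite_UN_I assms fin)
  have card_fib: "card (fib (m, n)) = (if m = 0 then 1 else 2) * (if n = 0 then 1 else 2)" for m n
  proof -
    have "card {int m, - int m} = (if m = 0 then 1 else 2)" for m by (auto simp: card_insert_if)
    then show ?thesis unfolding fib_def prod.case card_cartesian_product by simp
  qed
  have "card ?S = (\<Sum>t\<in>?T. card (fib t))"
    unfolding S by (rule card_UN_disjoint) (use assms fin in \<open>auto simp: fib_def\<close>)
  also have "?T = ((\<lambda>_. (0, 0)) ` {m::nat. m = 0 \<and> P 0 0} \<union> (\<lambda>m. (m, 0)) ` {m. 1 \<le> m \<and> P m 0}) \<union>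
      ((\<lambda>n. (0, n)) ` {n. 1 \<le> n \<and> P 0 n} \<union> {(m, n). 1 \<le> m \<and> 1 \<le> n \<and> P m n})"
    (is "_ = (?A \<union> ?B) \<union> (?C \<union> ?D)")
  proof (intro set_eqI iffI)
    fix t assume "t \<in> ?T"
    then obtain m n where "t = (m, n)" "P m n" by blast
    then show "t \<in> (?A \<union> ?B) \<union> (?C \<union> ?D)"
      by (cases "m = 0"; cases "n = 0") auto
  qed auto
  also have "(\<Sum>t\<in>(?A \<union> ?B) \<union> (?C \<union> ?D). card (fib t)) =
      ((\<Sum>t\<in>?A. card (fib t)) + (\<Sum>t\<in>?B. card (fib t))) + ((\<Sum>t\<in>?C. card (fib t)) + (\<Sum>t\<in>?D. card (fib t)))"
  proof -
    have "finite ((?A \<union> ?B) \<union> (?C \<union> ?D))" by (rule finite_subset[OF _ assms]) auto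
    then have "finite ?A" "finite ?B" "finite ?C" "finite ?D" unfolding finite_Un by blast+
    moreover have "?A \<inter> ?B = {}" "?C \<inter> ?D = {}" "(?A \<union> ?B) \<inter> (?C \<union> ?D) = {}" by auto
    ultimately show ?thesis by (simp only: sum.union_disjoint finite_Un)
  qed
  also have "(\<Sum>t\<in>?A. card (fib t)) = (if P 0 0 then 1 else 0)" by (simp add: card_fib)
  also have "(\<Sum>t\<in>?B. card (fib t)) = 2 * card {m. 1 \<le> m \<and> P m 0}"
    by (subst sum.reindex) (auto simp: inj_on_def card_fib)
  also have "(\<Sum>t\<in>?C. card (fib t)) = 2 * card {n. 1 \<le> n \<and> P 0 n}"
    by (subst sum.reindex) (auto simp: inj_on_def card_fib)
  also have "(\<Sum>t\<in>?D. card (fib t)) = 4 * card ?D"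
  proof -
    have "card (fib t) = 4" if "t \<in> ?D" for t using that by (auto simp: card_fib)
    then show ?thesis by simp
  qed
  finally show "card ?S =
      (if P 0 0 then 1 else 0) + 2 * card {m. 1 \<le> m \<and> P m 0} + 2 * card {n. 1 \<le> n \<and> P 0 n}
      + 4 * card ?D" by simp
qed

lemma lambda_minus_int: "lower_root k (of_int i) (of_int j) = lambda_minus k (nat \<bar>i\<bar>) (nat \<bar>j\<bar>)"
  using lower_root_abs[of k "of_int i" "of_int j"] by (simp add: lambda_minus_eq)

lemma upper_mode_sign:
  "\<not> mode_value k (False, m, n) < 0" "mode_value k (False, m, n) = 0 \<longleftrightarrow> m = 0 \<and> n = 0"
  using upper_root_pos[of "of_int m" "of_int n" k] lower_root_0[of k]
  by (cases "m = 0 \<and> n = 0"; force simp: mode_value.simps)+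

theorem theorem1p4:
  fixes k :: nat
  assumes "1 \<le> k"
  shows "proper_biharmonic (phi k) \<and>
         bi_nullity (phi k) = enat (5 + 4 * g_count k) \<and>
         bi_index (phi k) = enat (1 + 4 * (k - 1) + 4 * f_count k)"
proof (intro conjI proper_biharmonic_phi assms)
  note fin = finite_lambda_minus_nonpos[OF assms]
  have axes: "lambda_minus k 0 0 = - (real k ^ 4)"
    "1 \<le> m \<Longrightarrow> lambda_minus k m 0 < 0 \<longleftrightarrow> m < k" "1 \<le> m \<Longrightarrow> lambda_minus k m 0 = 0 \<longleftrightarrow> m = k"
    "1 \<le> m \<Longrightarrow> lambda_minus k 0 m < 0 \<longleftrightarrow> m < k" "1 \<le> m \<Longrightarrow> lambda_minus k 0 m = 0 \<longleftrightarrow> m = k" for m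
    using lower_root_0(1)[of k] lower_root_x_axis[OF assms, of m] lower_root_y_axis[OF assms, of m]
    by (simp_all add: lambda_minus_eq)
  show "bi_nullity (phi k) = enat (5 + 4 * g_count k)"
  proof -
    let ?Z = "{(i :: int, j :: int). lambda_minus k (nat \<bar>i\<bar>) (nat \<bar>j\<bar>) = 0}"
    have "finite {(m, n). lambda_minus k m n = 0}" by (rule finite_subset[OF _ fin]) auto
    note Z = card_int_pairs_by_abs[OF this]
    have "{m. 1 \<le> m \<and> lambda_minus k m 0 = 0} = {k}" "{n. 1 \<le> n \<and> lambda_minus k 0 n = 0} = {k}"
      using axes assms by auto
    then have card_Z: "card ?Z = 4 + 4 * g_count k"
      unfolding Z(2) g_count_def using assms by (simp add: axes(1))
    have modes: "{j. mode_value k j = 0} = insert (False, 0, 0) (Pair True ` ?Z)"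
    proof (intro set_eqI)
      fix j :: "bool \<times> int \<times> int"
      obtain s m n where j: "j = (s, m, n)" by (cases j)
      show "j \<in> {j. mode_value k j = 0} \<longleftrightarrow> j \<in> insert (False, 0, 0) (Pair True ` ?Z)"
        using upper_mode_sign(2)[of k m n] by (cases s) (auto simp: j lambda_minus_int mode_value.simps)
    qed
    have "card {j. mode_value k j = 0} = 5 + 4 * g_count k"
      unfolding modes using Z(1) by (subst card_insert_disjoint) (auto simp: card_image inj_on_def card_Z)
    moreover have "finite {j. mode_value k j = 0}" unfolding modes using Z(1) by simp
    ultimately show ?thesis using bi_nullity_eq_card by simp
  qed
  show "bi_index (phi k) = enat (1 + 4 * (k - 1) + 4 * f_count k)"
  proof -
    let ?N = "{(i :: int, j :: int). lambda_minus k (nat \<bar>i\<bar>) (nat \<bar>j\<bar>) < 0}"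
    have "finite {(m, n). lambda_minus k m n < 0}" by (rule finite_subset[OF _ fin]) auto
    note N = card_int_pairs_by_abs[OF this]
    have "{m. 1 \<le> m \<and> lambda_minus k m 0 < 0} = {1..<k}" "{n. 1 \<le> n \<and> lambda_minus k 0 n < 0} = {1..<k}"
      using axes by auto
    then have card_N: "card ?N = 1 + 4 * (k - 1) + 4 * f_count k"
      unfolding N(2) f_count_def using assms by (simp add: axes(1))
    have modes: "{j. mode_value k j < 0} = Pair True ` ?N"
    proof (intro set_eqI)
      fix j :: "bool \<times> int \<times> int"
      obtain s m n where j: "j = (s, m, n)" by (cases j)
      show "j \<in> {j. mode_value k j < 0} \<longleftrightarrow> j \<in> Pair True ` ?N"
        using upper_mode_sign(1)[of k m n] by (cases s) (auto simp: j lambda_minus_int mode_value.simps)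
    qed
    have "card {j. mode_value k j < 0} = card ?N"
      unfolding modes by (intro card_image) (auto simp: inj_on_def)
    moreover have "finite {j. mode_value k j < 0}" unfolding modes using N(1) by simp
    ultimately show ?thesis using bi_index_eq_card card_N by simp
  qed
qed

end
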